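(* Let $p$ be a prime number, let $n \geq 3$ be an integer, and let $$f(X) = X^n + a_{n-1}X^{n-1} + \cdots + a_1 X + a_0 \in \mathbb{F}_p[X]$$ be a primitive polynomial of degree $n$. Let $C$ be the companion matrix of $f$, let $G$ be the companion matrix of $X^n - 1 \in \mathbb{F}_p[X]$, and define $G_1 := C$ and $G_{k+1} := G\,G_k\,G^{-1}$ for all $1 \leq k \leq n-1$. If $p \geq 5$ and $n$ is not divisible by $p-1$, then $$\langle G_1, G_2, \ldots, G_n \rangle = \mathrm{GL}_n(\mathbb{F}_p).$$
   Context: The companion matrix of a monic polynomial $X^n + b_{n-1}X^{n-1} + \cdots + b_1 X + b_0 \in \mathbb{F}_p[X]$ is the $n \times n$ matrix $M$ over $\mathbb{F}_p$ with $M E_k = E_{k+1}$ for $1 \leq k \leq n-1$ and $M E_n = \sum_{i=1}^n -b_{i-1} E_i$, where $E_1,\dots,E_n$ is the canonical basis of column vectors (ones on the subdiagonal, last column $(-b_0, -b_1, \ldots, -b_{n-1})^T$, zeros elsewhere). A monic polynomial $f \in \mathbb{F}_p[X]$ of degree $n$ is primitive if it is the minimal polynomial over $\mathbb{F}_p$ of a generator of the cyclic group $\mathbb{F}_{p^n}^\times$. $\langle \cdots \rangle$ denotes the subgroup of $\mathrm{GL}_n(\mathbb{F}_p)$ generated by the listed elements. *)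

theory Defs
  imports
    "Berlekamp_Zassenhaus.Finite_Field"
    "Jordan_Normal_Form.Matrix"
    "HOL-Algebra.Generated_Groups"
    "HOL-Algebra.Algebraic_Closure_Type"
begin

text \<open>The prime field \<open>F_p\<close> is the type \<^typ>\<open>'p::prime_card mod_ring\<close>, with \<open>p = CARD('p)\<close>.\<close>

text \<open>Matrix indices start at 0, so the vector \<open>E_k\<close> of the canonical basis has index \<open>k - 1\<close>.\<close>

definition companion_mat :: "'a::comm_ring_1 poly \<Rightarrow> 'a mat" where
  "companion_mat f =
     (let n = Polynomial.degree f in
      mat n n (\<lambda>(i, j). if j = n - 1 then - Polynomial.coeff f i
                         else if i = j + 1 then 1 else 0))"

definition GL :: "'a::field itself \<Rightarrow> nat \<Rightarrow> 'a mat monoid" where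
  "GL ty n = units_of (ring_mat ty n ())"

definition is_minimal_poly :: "'a::field poly \<Rightarrow> 'a alg_closure \<Rightarrow> bool" where
  "is_minimal_poly f x \<longleftrightarrow>
     Polynomial.lead_coeff f = 1 \<and> poly (map_poly to_ac f) x = 0 \<and>
     (\<forall>g. g \<noteq> 0 \<and> poly (map_poly to_ac g) x = 0
          \<longrightarrow> Polynomial.degree f \<le> Polynomial.degree g)"

text \<open>The field \<open>F_{p^n}\<close> is taken as the (unique) subfield \<open>K\<close> of order \<open>p^n\<close> of the algebraic
  closure of \<open>F_p\<close>. The condition on \<open>x\<close> says that \<open>x\<close> generates the group of nonzero
  elements of \<open>K\<close>.\<close>

definition primitive_poly :: "'p::prime_card mod_ring poly \<Rightarrow> bool" where
  "primitive_poly f \<longleftrightarrow>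
     (\<exists>(K :: 'p mod_ring alg_closure set) x.
        subfield K ring_of_type_algebra \<and> card K = CARD('p) ^ Polynomial.degree f \<and>
        K - {0} = range (\<lambda>k::int. x powi k) \<and>
        is_minimal_poly f x)"

end

theory Submission
  imports Defs "Jordan_Normal_Form.Determinant"
begin

text \<open>
  Let \<open>H\<close> be the subgroup generated by the \<open>G_k\<close>. Two elements carry the proof. The companion
  matrix \<open>C = G_1\<close> acts on \<open>F_p^n\<close> as multiplication by a generator of the multiplicative group of
  \<open>F_{p^n}\<close> (a Singer cycle), so its powers permute the nonzero vectors transitively, and the nonzero
  linear forms as well; its determinant is the norm of that generator and hence generates the
  nonzero elements of \<open>F_p\<close>. The quotient \<open>D = C * inv G\<close> is a homology: it fixes the hyperplane
  \<open>x_1 = 0\<close> pointwise and stretches a complementary line by \<open>d = -a_0\<close>. Conjugation by \<open>G\<close> permutes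
  the \<open>G_k\<close> cyclically, because \<open>G ^ n = 1\<close>; so \<open>G\<close>, and with it \<open>D\<close>, normalises \<open>H\<close>. Write
  \<open>1 + u \<phi>\<close> for the map sending \<open>y\<close> to \<open>y + \<phi>(y) u\<close>. It is a homology with ratio
  \<open>1 + \<phi>(u)\<close>, or a transvection if \<open>\<phi>(u) = 0\<close>.

  The coset \<open>D H\<close> is closed under conjugation by its own elements and by \<open>H\<close>. By transitivity every
  line is the centre, and every hyperplane the axis, of a homology of ratio \<open>d\<close> in \<open>D H\<close>, while the
  quotient of two elements of \<open>D H\<close> lies in \<open>H\<close>.

  Transvections exist in \<open>H\<close>. If two homologies in \<open>D H\<close> with the same centre differ, their quotient
  is a transvection in \<open>H\<close>. Otherwise each line \<open>u\<close> has exactly one homology, with axis \<open>u^\<bottom>\<close>.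
  Since conjugation preserves the family, \<open>\<bottom>\<close> is symmetric: it is a polarity without
  self-orthogonal points. Take pairwise orthogonal \<open>u\<close>, \<open>v\<close>, \<open>w\<close>, which needs \<open>n \<ge> 3\<close>. In these
  coordinates the linearity of the hyperplanes forces \<open>\<bottom>\<close> to be given by a diagonal bilinear
  form (\<open>no_twisted_polarity\<close>), but the homologies of ratio \<open>d\<close> preserve such a form only if
  \<open>d ^ 2 = 1\<close>. This is excluded, as \<open>d ^ 2\<close> is the square of a generator of a cyclic group of order
  \<open>p - 1 \<ge> 4\<close>.

  All transvections lie in \<open>H\<close>. Each vector is now the centre of some transvection. Commutators of
  transvections with homologies show that for a homology with axis \<open>W\<close>, every transvection with
  axis \<open>W\<close> lies in \<open>H\<close> (\<open>T_homology_axis\<close>), and every hyperplane is such an axis.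

  Transvections generate \<open>SL_n\<close> by column reduction, and \<open>det C\<close> generates the group of all
  determinants, so \<open>H = GL_n\<close>.
\<close>

section \<open>Polarities without self-orthogonal points\<close>

text \<open>
  \<open>(U a b c, V a b c, W a b c)\<close> are the coordinates of the linear form \<open>B(y, _)\<close> at
  \<open>y = a u + b v + c w\<close>, where \<open>u\<close>, \<open>v\<close>, \<open>w\<close> are pairwise orthogonal, \<open>B(y, y) = 1\<close> and orthogonality is
  symmetric. The proof is a hands-on case of the fundamental theorem of projective geometry: the
  ratio \<open>V / U\<close> depends on \<open>b / a\<close> only, likewise for the other two pairs, and the three resulting
  functions satisfy a Pexider equation, so up to constants all of them are one multiplicative
  function \<open>\<chi>\<close>. Symmetry of orthogonality yields \<open>\<chi>(t) + \<chi>(1 - t) = 1\<close>, so \<open>\<chi>\<close> is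
  the identity on a prime field. But the homology with centre \<open>v\<close> gives \<open>\<chi>(1 / d) = d\<close>.
\<close>
lemma no_twisted_polarity:
  fixes U V W :: "'a::field \<Rightarrow> 'a \<Rightarrow> 'a \<Rightarrow> 'a" and d :: 'a
  assumes prime_field: "\<And>x::'a. \<exists>m. x = of_nat m"
    and two: "(2::'a) \<noteq> 0" and d: "d \<noteq> 0" "d * d \<noteq> 1"
    and self: "\<And>a b c. (a, b, c) \<noteq> (0, 0, 0) \<Longrightarrow> a * U a b c + b * V a b c + c * W a b c = 1"
    and sym: "\<And>a b c a' b' c'. (a, b, c) \<noteq> (0, 0, 0) \<Longrightarrow> (a', b', c') \<noteq> (0, 0, 0) \<Longrightarrow>
        a' * U a b c + b' * V a b c + c' * W a b c = 0 \<Longrightarrow> a * U a' b' c' + b * V a' b' c' + c * W a' b' c' = 0"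
    and vert: "U 0 1 0 = 0" "V 1 0 0 = 0" "W 1 0 0 = 0" "U 0 0 1 = 0" "V 0 0 1 = 0" "W 0 1 0 = 0"
    and equiv: "\<And>a b c. (a, b, c) \<noteq> (0, 0, 0) \<Longrightarrow> U a (b / d) c = U a b c"
               "\<And>a b c. (a, b, c) \<noteq> (0, 0, 0) \<Longrightarrow> V a (b / d) c = d * V a b c"
  shows False
proof -
  have vert1: "U 1 0 0 = 1" "V 0 1 0 = 1" "W 0 0 1 = 1"
    using self[of 1 0 0] self[of 0 1 0] self[of 0 0 1] by auto
  have U0: "U a b c = 0 \<longleftrightarrow> a = 0" if "(a, b, c) \<noteq> (0, 0, 0)" for a b c
    using sym[of 1 0 0 a b c] sym[of a b c 1 0 0] that vert vert1 by auto
  have V0: "V a b c = 0 \<longleftrightarrow> b = 0" if "(a, b, c) \<noteq> (0, 0, 0)" for a b c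
    using sym[of 0 1 0 a b c] sym[of a b c 0 1 0] that vert vert1 by auto
  have W0: "W a b c = 0 \<longleftrightarrow> c = 0" if "(a, b, c) \<noteq> (0, 0, 0)" for a b c
    using sym[of 0 0 1 a b c] sym[of a b c 0 0 1] that vert vert1 by auto
  define q where "q a = V 1 a 0 / U 1 a 0" for a
  define q' where "q' b = W 1 0 b / U 1 0 b" for b
  define q'' where "q'' c = W 0 1 c / V 0 1 c" for c
  have q0: "q a \<noteq> 0" "q' a \<noteq> 0" "q'' a \<noteq> 0" if "a \<noteq> 0" for a
    using U0[of 1 a 0] V0[of 1 a 0] U0[of 1 0 a] W0[of 1 0 a] V0[of 0 1 a] W0[of 0 1 a] that
    by (auto simp: q_def q'_def q''_def)
  \<comment> \<open>The point \<open>z = u + s v\<close> orthogonal to \<open>u + a v\<close> is also orthogonal to \<open>w\<close>, hence to \<open>u + a v + b w\<close>.\<close>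
  have qV: "V 1 a b = q a * U 1 a b" if a: "a \<noteq> 0" for a b
  proof -
    define s where "s = - 1 / q a"
    have "U 1 a 0 + s * V 1 a 0 = 0"
      using q0[OF a] U0[of 1 a 0] V0[of 1 a 0] a by (auto simp: s_def q_def field_simps)
    then have "U 1 s 0 + a * V 1 s 0 = 0"
      using sym[of 1 a 0 1 s 0] by simp
    moreover have "W 1 s 0 = 0" using W0[of 1 s 0] by simp
    ultimately have "U 1 a b + s * V 1 a b = 0" using sym[of 1 s 0 1 a b] by simp
    then show ?thesis using q0[OF a] by (auto simp: s_def field_simps)
  qed
  have q'W: "W 1 a b = q' b * U 1 a b" if b: "b \<noteq> 0" for a b
  proof -
    define s where "s = - 1 / q' b"
    have "U 1 0 b + s * W 1 0 b = 0"
      using q0[OF b] U0[of 1 0 b] W0[of 1 0 b] b by (auto simp: s_def q'_def field_simps)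
    then have "U 1 0 s + b * W 1 0 s = 0"
      using sym[of 1 0 b 1 0 s] by simp
    moreover have "V 1 0 s = 0" using V0[of 1 0 s] by simp
    ultimately have "U 1 a b + s * W 1 a b = 0" using sym[of 1 0 s 1 a b] by simp
    then show ?thesis using q0[OF b] by (auto simp: s_def field_simps)
  qed
  have q''W: "W 1 a (a * c) = q'' c * V 1 a (a * c)" if a: "a \<noteq> 0" and c: "c \<noteq> 0" for a c
  proof -
    define s where "s = - 1 / q'' c"
    have "V 0 1 c + s * W 0 1 c = 0"
      using q0[OF c] V0[of 0 1 c] W0[of 0 1 c] c by (auto simp: s_def q''_def field_simps)
    then have z: "V 0 1 s + c * W 0 1 s = 0"
      using sym[of 0 1 c 0 1 s] by simp
    have "U 0 1 s = 0" using U0[of 0 1 s] by simp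
    moreover have "a * V 0 1 s + a * c * W 0 1 s = a * (V 0 1 s + c * W 0 1 s)"
      by (simp add: algebra_simps)
    ultimately have "V 1 a (a * c) + s * W 1 a (a * c) = 0"
      using sym[of 0 1 s 1 a "a * c"] z by simp
    then show ?thesis using q0[OF c] by (auto simp: s_def field_simps)
  qed
  have pexider: "q' (a * c) = q'' c * q a" if "a \<noteq> 0" "c \<noteq> 0" for a c
    using q''W[OF that] q'W[of "a * c" a] qV[of a "a * c"] U0[of 1 a "a * c"] that by auto
  define \<chi> where "\<chi> a = q a / q 1" for a
  define s where "s = q 1"
  define k where "k = q' 1 / q 1"
  have sk: "s \<noteq> 0" "k \<noteq> 0" using q0[of 1] by (auto simp: s_def k_def)
  have q: "q a = s * \<chi> a" for a using q0[of 1] by (simp add: \<chi>_def s_def)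
  have q''1: "q'' 1 = k" using pexider[of 1 1] q0[of 1] by (auto simp: k_def)
  have q': "q' a = k * s * \<chi> a" if "a \<noteq> 0" for a
    using pexider[of a 1] that q''1 by (simp add: q)
  have \<chi>1: "\<chi> 1 = 1" using q0[of 1] by (simp add: \<chi>_def)
  have \<chi>0: "\<chi> a \<noteq> 0" if "a \<noteq> 0" for a using q0(1)[OF that] by (auto simp: q)
  have \<chi>mult: "\<chi> (a * b) = \<chi> a * \<chi> b" if "a \<noteq> 0" "b \<noteq> 0" for a b
  proof -
    have "k * s * \<chi> b = q'' b * s" using pexider[of 1 b] that q' \<chi>1 by (simp add: q)
    then have "q'' b = k * \<chi> b" using sk by simp
    then show ?thesis using pexider[of a b] that sk by (simp add: q q')
  qed
  have orth1: "1 + a * (s * \<chi> a') = 0" if "1 + a' * (s * \<chi> a) = 0" "a \<noteq> 0" "a' \<noteq> 0" for a a'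
  proof -
    have "U 1 a 0 + a' * V 1 a 0 = U 1 a 0 * (1 + a' * (s * \<chi> a))"
      using qV[OF that(2)] by (simp add: q algebra_simps)
    then have "U 1 a 0 + a' * V 1 a 0 = 0" using that(1) by simp
    then have "U 1 a' 0 + a * V 1 a' 0 = 0" using sym[of 1 a 0 1 a' 0] by simp
    moreover have "U 1 a' 0 + a * V 1 a' 0 = U 1 a' 0 * (1 + a * (s * \<chi> a'))"
      using qV[OF that(3)] by (simp add: q algebra_simps)
    ultimately have "U 1 a' 0 * (1 + a * (s * \<chi> a')) = 0" by simp
    then show ?thesis using U0[of 1 a' 0] by simp
  qed
  have orth2: "1 + a * (k * s * \<chi> a') = 0" if "1 + a' * (k * s * \<chi> a) = 0" "a \<noteq> 0" "a' \<noteq> 0" for a a'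
  proof -
    have "U 1 0 a + a' * W 1 0 a = U 1 0 a * (1 + a' * (k * s * \<chi> a))"
      using q'W[OF that(2)] q'[OF that(2)] by (simp add: algebra_simps)
    then have "U 1 0 a + a' * W 1 0 a = 0" using that(1) by simp
    then have "U 1 0 a' + a * W 1 0 a' = 0" using sym[of 1 0 a 1 0 a'] by simp
    moreover have "U 1 0 a' + a * W 1 0 a' = U 1 0 a' * (1 + a * (k * s * \<chi> a'))"
      using q'W[OF that(3)] q'[OF that(3)] by (simp add: algebra_simps)
    ultimately have "U 1 0 a' * (1 + a * (k * s * \<chi> a')) = 0" by simp
    then show ?thesis using U0[of 1 0 a'] by simp
  qed
  have orth3: "1 + a * (s * \<chi> a') + b * (k * s * \<chi> b') = 0"
    if "1 + a' * (s * \<chi> a) + b' * (k * s * \<chi> b) = 0" "a \<noteq> 0" "a' \<noteq> 0" "b \<noteq> 0" "b' \<noteq> 0" for a a' b b'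
  proof -
    have "U 1 a b + a' * V 1 a b + b' * W 1 a b = U 1 a b * (1 + a' * (s * \<chi> a) + b' * (k * s * \<chi> b))"
      using qV[OF that(2)] q'W[OF that(4)] q'[OF that(4)] by (simp add: q algebra_simps)
    then have "U 1 a b + a' * V 1 a b + b' * W 1 a b = 0" using that(1) by simp
    then have "U 1 a' b' + a * V 1 a' b' + b * W 1 a' b' = 0" using sym[of 1 a b 1 a' b'] by simp
    moreover have "U 1 a' b' + a * V 1 a' b' + b * W 1 a' b' = U 1 a' b' * (1 + a * (s * \<chi> a') + b * (k * s * \<chi> b'))"
      using qV[OF that(3)] q'W[OF that(5)] q'[OF that(5)] by (simp add: q algebra_simps)
    ultimately have "U 1 a' b' * (1 + a * (s * \<chi> a') + b * (k * s * \<chi> b')) = 0" by simp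
    then show ?thesis using U0[of 1 a' b'] by simp
  qed
  \<comment> \<open>The points \<open>u + v\<close> and \<open>u - (1/s) v\<close> are orthogonal, and likewise \<open>u + w\<close> and \<open>u - (1/(k s)) w\<close>. Affine
    combinations of the second points of both pairs are orthogonal to \<open>u + v + w\<close>, which gives \<open>add1\<close>.\<close>
  have \<chi>s: "s * \<chi> (- 1 / s) = - 1"
    using orth1[of "- 1 / s" 1] sk \<chi>1 by (simp add: eq_neg_iff_add_eq_0 add.commute)
  have \<chi>ks: "k * s * \<chi> (- 1 / (k * s)) = - 1"
    using orth2[of "- 1 / (k * s)" 1] sk \<chi>1 by (simp add: eq_neg_iff_add_eq_0 add.commute)
  have add1: "\<chi> t + \<chi> (1 - t) = 1" if t: "t \<noteq> 0" "t \<noteq> 1" for t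
  proof -
    have "1 + 1 * (s * \<chi> (t * (- 1 / s))) + 1 * (k * s * \<chi> ((1 - t) * (- 1 / (k * s)))) = 0"
      by (rule orth3) (use t sk \<chi>1 in \<open>auto simp: field_simps\<close>)
    moreover have "\<chi> (t * (- 1 / s)) = \<chi> t * \<chi> (- 1 / s)"
      using t sk by (intro \<chi>mult) auto
    moreover have "\<chi> ((1 - t) * (- 1 / (k * s))) = \<chi> (1 - t) * \<chi> (- 1 / (k * s))"
      using t sk by (intro \<chi>mult) auto
    ultimately have "1 + \<chi> t * (s * \<chi> (- 1 / s)) + \<chi> (1 - t) * (k * s * \<chi> (- 1 / (k * s))) = 0"
      by (simp add: algebra_simps)
    then show ?thesis unfolding \<chi>s \<chi>ks by (simp add: algebra_simps)
  qed
  have m1: "\<chi> (- 1) = - 1"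
  proof -
    have "\<chi> (- 1) * \<chi> (- 1) = 1" using \<chi>mult[of "- 1" "- 1"] \<chi>1 by simp
    then have "(\<chi> (- 1) - 1) * (\<chi> (- 1) + 1) = 0" by (simp add: algebra_simps)
    moreover have "\<chi> (- 1) \<noteq> 1"
    proof
      \<comment> \<open>Then \<open>\<chi>(2) = 0\<close>, by \<open>add1\<close> at \<open>t = -1\<close>.\<close>
      assume "\<chi> (- 1) = 1"
      moreover have "\<chi> (- 1) + \<chi> 2 = 1" using add1[of "- 1"] two
        by (metis add.inverse_neutral diff_minus_eq_add one_add_one neg_equal_zero zero_neq_one neg_equal_iff_equal add_cancel_left_left eq_neg_iff_add_eq_0)
      ultimately show False using \<chi>0[OF two] by simp
    qed
    ultimately show ?thesis by (simp add: eq_neg_iff_add_eq_0)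
  qed
  have succ: "\<chi> (1 + t) = 1 + \<chi> t" if t: "t \<noteq> 0" "1 + t \<noteq> 0" for t
  proof -
    have "\<chi> (- t) + \<chi> (1 + t) = 1"
      using add1[of "- t"] t by (metis add.commute diff_minus_eq_add neg_equal_0_iff_equal neg_eq_iff_add_eq_0)
    moreover have "\<chi> (- t) = - \<chi> t" using \<chi>mult[of "- 1" t] t m1 by simp
    ultimately show ?thesis by (simp add: algebra_simps)
  qed
  have id: "of_nat m \<noteq> (0::'a) \<longrightarrow> \<chi> (of_nat m) = of_nat m" for m
  proof (induction m)
    case (Suc m)
    then show ?case using succ[of "of_nat m"] \<chi>1 by (cases "of_nat m = (0::'a)") auto
  qed simp
  have "\<chi> (1 / d) = 1 / d" using id prime_field[of "1 / d"] d by force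
  moreover have "\<chi> (1 / d) = d"
    using equiv[of 1 1 0] q0[of 1] by (simp add: \<chi>_def q_def)
  ultimately show False using d by (simp add: field_simps)
qed

section \<open>Families of homologies and transvections\<close>

text \<open>
  The square matrix with the two forms as first rows and zero rows below them is singular.
\<close>
lemma exists_common_kernel_vec:
  fixes \<phi> \<psi> :: "'a::field vec"
  assumes "\<phi> \<in> carrier_vec n" "\<psi> \<in> carrier_vec n" "n \<ge> 3"
  shows "\<exists>w\<in>carrier_vec n. w \<noteq> 0\<^sub>v n \<and> \<phi> \<bullet> w = 0 \<and> \<psi> \<bullet> w = 0"
proof -
  define A where "A = mat n n (\<lambda>(i, j). if i = 0 then \<phi> $ j else if i = 1 then \<psi> $ j else 0)"
  have A: "A \<in> carrier_mat n n" by (simp add: A_def)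
  have r: "row A 0 = \<phi>" "row A 1 = \<psi>" "row A 2 = 0\<^sub>v n"
    using assms by (auto simp: A_def)
  have "det A = (\<Sum>j<n. A $$ (2, j) * cofactor A 2 j)"
    using assms by (intro laplace_expansion_row[OF A]) auto
  also have "\<dots> = 0" using assms by (intro sum.neutral) (auto simp: A_def)
  finally obtain w where w: "w \<in> carrier_vec n" "w \<noteq> 0\<^sub>v n" "A *\<^sub>v w = 0\<^sub>v n"
    using det_0_iff_vec_prod_zero_field[OF A] by auto
  have "row A i \<bullet> w = 0" if "i < n" for i
    using arg_cong[OF w(3), of "\<lambda>x. vec_index x i"] that A by auto
  from this[of 0] this[of 1] show ?thesis using r w assms by auto
qed

text \<open>
  \<open>R u \<phi>\<close> says that the homology \<open>1 + u \<phi>\<close> of ratio \<open>d\<close> belongs to the coset \<open>D H\<close>, and \<open>T v \<phi>\<close>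
  that the transvection \<open>1 + v \<phi>\<close> belongs to \<open>H\<close>. The assumptions record what conjugation and
  multiplication inside \<open>D H\<close> and \<open>H\<close> say about centres and axes, so that the geometric argument
  runs without matrices. The formulas in \<open>R_conj\<close> and \<open>T_conj\<close> are the images of centre and axis under
  conjugation by the inverse of \<open>1 + u \<phi>\<close>. \<open>T_mono_eq\<close> holds because the number of transvections with
  a given centre does not depend on the centre.
\<close>
locale homology_geometry =
  fixes n :: nat and d :: "'p::prime_card mod_ring"
    and R T :: "'p mod_ring vec \<Rightarrow> 'p mod_ring vec \<Rightarrow> bool"
  assumes dim: "n \<ge> 3" and two: "(2::'p mod_ring) \<noteq> 0" and d: "d \<noteq> 0" "d * d \<noteq> 1"
    and R_carrier: "\<And>u \<phi>. R u \<phi> \<Longrightarrow> u \<in> carrier_vec n \<and> \<phi> \<in> carrier_vec n \<and> \<phi> \<bullet> u = d - 1"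
    and T_carrier: "\<And>v \<phi>. T v \<phi> \<Longrightarrow> v \<in> carrier_vec n \<and> \<phi> \<in> carrier_vec n \<and> \<phi> \<bullet> v = 0"
    and R_diff: "\<And>u \<phi> \<psi>. R u \<phi> \<Longrightarrow> R u \<psi> \<Longrightarrow> T u (\<psi> - \<phi>)"
    and R_add: "\<And>u \<phi> \<psi>. R u \<phi> \<Longrightarrow> T u \<psi> \<Longrightarrow> R u (\<phi> + \<psi>)"
    and R_conj: "\<And>u \<phi> v \<psi>. R u \<phi> \<Longrightarrow> R v \<psi> \<Longrightarrow> R (v - (\<phi> \<bullet> v / d) \<cdot>\<^sub>v u) (\<psi> + (\<psi> \<bullet> u) \<cdot>\<^sub>v \<phi>)"
    and T_conj: "\<And>u \<phi> v \<psi>. R u \<phi> \<Longrightarrow> T v \<psi> \<Longrightarrow> T (v - (\<phi> \<bullet> v / d) \<cdot>\<^sub>v u) (\<psi> + (\<psi> \<bullet> u) \<cdot>\<^sub>v \<phi>)"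
    and T_add_axis: "\<And>v \<phi> \<psi>. T v \<phi> \<Longrightarrow> T v \<psi> \<Longrightarrow> T v (\<phi> + \<psi>)"
    and T_add_center: "\<And>u v \<phi>. T u \<phi> \<Longrightarrow> T v \<phi> \<Longrightarrow> T (u + v) \<phi>"
    and T_smult_axis: "\<And>v \<phi> c. T v \<phi> \<Longrightarrow> T v (c \<cdot>\<^sub>v \<phi>)"
    and T_smult_center: "\<And>v \<phi> c. T v \<phi> \<Longrightarrow> T (c \<cdot>\<^sub>v v) \<phi>"
    and R_center: "\<And>u. u \<in> carrier_vec n \<Longrightarrow> u \<noteq> 0\<^sub>v n \<Longrightarrow> \<exists>\<phi>. R u \<phi>"
    and R_axis: "\<And>\<phi>. \<phi> \<in> carrier_vec n \<Longrightarrow> \<phi> \<noteq> 0\<^sub>v n \<Longrightarrow> \<exists>u. R u \<phi>"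
    and T_mono_eq: "\<And>u v \<phi>. u \<in> carrier_vec n \<Longrightarrow> u \<noteq> 0\<^sub>v n \<Longrightarrow> v \<in> carrier_vec n \<Longrightarrow> v \<noteq> 0\<^sub>v n \<Longrightarrow>
        (\<And>\<psi>. T v \<psi> \<Longrightarrow> T u \<psi>) \<Longrightarrow> T u \<phi> \<Longrightarrow> T v \<phi>"
begin

lemma d1: "d - 1 \<noteq> 0"
  using d(2) by auto

lemma R_nonzero: assumes "R u \<phi>" shows "u \<noteq> 0\<^sub>v n" "\<phi> \<noteq> 0\<^sub>v n"
  using R_carrier[OF assms] d1 by auto

text \<open>
  Without transvections, each \<open>u\<close> has a unique form \<open>P u\<close> with \<open>R u (P u)\<close>. The homology of \<open>u\<close> fixes any
  \<open>y\<close> in the kernel of \<open>P u\<close>, so by uniqueness it fixes \<open>P y\<close>, which gives symmetry of orthogonality.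
  The coordinates of \<open>P\<close> in an orthogonal frame then contradict \<open>no_twisted_polarity\<close>.
\<close>
lemma exists_transvection: "\<exists>v \<phi>. T v \<phi> \<and> v \<noteq> 0\<^sub>v n \<and> \<phi> \<noteq> 0\<^sub>v n"
proof (rule ccontr)
  assume no: "\<not> ?thesis"
  have uniq: "\<phi> = \<psi>" if "R u \<phi>" "R u \<psi>" for u \<phi> \<psi>
  proof -
    have "\<psi> - \<phi> = 0\<^sub>v n" using no R_diff[OF that] R_nonzero[OF that(1)] by auto
    moreover have c: "\<phi> \<in> carrier_vec n" "\<psi> \<in> carrier_vec n" using R_carrier that by auto
    ultimately have "\<phi> $ i = \<psi> $ i" if "i < n" for i
      using that by (metis index_minus_vec(1) index_zero_vec(1) carrier_vecD eq_iff_diff_eq_0)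
    then show ?thesis using c by (intro eq_vecI) auto
  qed
  obtain P where P: "R u (P u)" if "u \<in> carrier_vec n" "u \<noteq> 0\<^sub>v n" for u
    using R_center by metis
  \<comment> \<open>Normalised so that \<open>B x x = 1\<close>; linear in \<open>y\<close> only.\<close>
  define B where "B x y = (P x \<bullet> y) / (d - 1)" for x y
  have Pc: "P x \<in> carrier_vec n" "P x \<bullet> x = d - 1" if "x \<in> carrier_vec n" "x \<noteq> 0\<^sub>v n" for x
    using R_carrier[OF P[OF that]] by auto
  have conj: "P (y - (P x \<bullet> y / d) \<cdot>\<^sub>v x) = P y + (P y \<bullet> x) \<cdot>\<^sub>v P x"
    if x: "x \<in> carrier_vec n" "x \<noteq> 0\<^sub>v n" and y: "y \<in> carrier_vec n" "y \<noteq> 0\<^sub>v n" for x y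
    using R_conj[OF P[OF x] P[OF y]] R_carrier R_nonzero uniq P by metis
  have sym0: "P y \<bullet> x = 0"
    if x: "x \<in> carrier_vec n" "x \<noteq> 0\<^sub>v n" and y: "y \<in> carrier_vec n" "y \<noteq> 0\<^sub>v n"
      and xy: "P x \<bullet> y = 0" for x y
  proof -
    have "y - (P x \<bullet> y / d) \<cdot>\<^sub>v x = y" using x y xy by auto
    then have "P y = P y + (P y \<bullet> x) \<cdot>\<^sub>v P x" using conj[OF x y] by metis
    then have "P y \<bullet> x = P y \<bullet> x + (P y \<bullet> x) * (P x \<bullet> x)"
      using Pc[OF x] Pc[OF y] x y
      by (metis add_scalar_prod_distrib smult_carrier_vec smult_scalar_prod_distrib)
    then show ?thesis using Pc[OF x] d1 by simp
  qed
  have B_sym: "B y x = 0" if "x \<in> carrier_vec n" "x \<noteq> 0\<^sub>v n" "y \<in> carrier_vec n" "y \<noteq> 0\<^sub>v n" "B x y = 0" for x y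
    using sym0[OF that(1-4)] that(5) d1 by (auto simp: B_def)
  have B_self: "B x x = 1" if "x \<in> carrier_vec n" "x \<noteq> 0\<^sub>v n" for x
    using Pc[OF that] d1 by (simp add: B_def)
  define u where "u = (unit_vec n 0 :: 'p mod_ring vec)"
  have u: "u \<in> carrier_vec n" "u \<noteq> 0\<^sub>v n" using dim by (auto simp: u_def)
  obtain v where v: "v \<in> carrier_vec n" "v \<noteq> 0\<^sub>v n" "P u \<bullet> v = 0"
    using exists_common_kernel_vec[OF Pc(1)[OF u] Pc(1)[OF u] dim] by auto
  obtain w where w: "w \<in> carrier_vec n" "w \<noteq> 0\<^sub>v n" "P u \<bullet> w = 0" "P v \<bullet> w = 0"
    using exists_common_kernel_vec[OF Pc(1)[OF u] Pc(1)[OF v(1,2)] dim] by auto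
  have B_orth: "B u v = 0" "B u w = 0" "B v w = 0" "B v u = 0" "B w u = 0" "B w v = 0"
    using v w u sym0 by (auto simp: B_def)
  define Y where "Y a b c = a \<cdot>\<^sub>v u + b \<cdot>\<^sub>v v + c \<cdot>\<^sub>v w" for a b c
  have Yc [simp]: "Y a b c \<in> carrier_vec n" for a b c using u v w by (simp add: Y_def)
  have B_Y: "B x (Y a b c) = a * B x u + b * B x v + c * B x w"
    if x: "x \<in> carrier_vec n" "x \<noteq> 0\<^sub>v n" for x a b c
    using Pc(1)[OF x] u v w
    by (simp add: B_def Y_def scalar_prod_add_distrib[of _ n] add_divide_distrib)
  have B_Y_basis: "B u (Y a b c) = a" "B v (Y a b c) = b" "B w (Y a b c) = c" for a b c
    using B_Y u v w B_orth B_self by simp_all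
  have Y0: "Y a b c \<noteq> 0\<^sub>v n" if "(a, b, c) \<noteq> (0, 0, 0)" for a b c
  proof
    assume z: "Y a b c = 0\<^sub>v n"
    have "B x (0\<^sub>v n) = 0" if "x \<in> carrier_vec n" "x \<noteq> 0\<^sub>v n" for x
      using Pc(1)[OF that] by (simp add: B_def)
    then show False using B_Y_basis[of a b c] z that u v w by simp
  qed
  have basis_Y: "Y 1 0 0 = u" "Y 0 1 0 = v" "Y 0 0 1 = w"
    using u v w by (auto simp: Y_def)
  \<comment> \<open>The inverse of the homology with centre \<open>v\<close> divides the \<open>v\<close>-coordinate by \<open>d\<close>.\<close>
  have turn: "Y a (b / d) c = Y a b c - (P v \<bullet> Y a b c / d) \<cdot>\<^sub>v v" for a b c
  proof -
    have "P v \<bullet> Y a b c = b * (d - 1)" using B_Y_basis(2)[of a b c] d1 by (simp add: B_def field_simps)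
    then have "Y a b c - (P v \<bullet> Y a b c / d) \<cdot>\<^sub>v v = Y a b c - (b * (d - 1) / d) \<cdot>\<^sub>v v" by simp
    also have "\<dots> = Y a (b / d) c" using u v w d unfolding Y_def
      by (intro eq_vecI) (auto simp: field_simps)
    finally show ?thesis by simp
  qed
  have B_turn: "B (Y a (b / d) c) x = B (Y a b c) x + (d - 1) * B (Y a b c) v * B v x"
    if Y: "(a, b, c) \<noteq> (0, 0, 0)" and x: "x \<in> carrier_vec n" for a b c x
  proof -
    have "P (Y a (b / d) c) = P (Y a b c) + (P (Y a b c) \<bullet> v) \<cdot>\<^sub>v P v"
      unfolding turn using conj v Y0[OF Y] Yc by blast
    then have "P (Y a (b / d) c) \<bullet> x = P (Y a b c) \<bullet> x + (P (Y a b c) \<bullet> v) * (P v \<bullet> x)"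
      using Pc(1)[OF Yc Y0[OF Y]] Pc(1)[OF v(1,2)] x by (simp add: add_scalar_prod_distrib[of _ n])
    moreover have "P z \<bullet> y = (d - 1) * B z y" for z y using d1 by (simp add: B_def)
    ultimately have "(d - 1) * B (Y a (b / d) c) x =
        (d - 1) * (B (Y a b c) x + (d - 1) * B (Y a b c) v * B v x)"
      by (simp add: algebra_simps)
    then show ?thesis using d1 by simp
  qed
  show False
  proof (rule no_twisted_polarity[of d "\<lambda>a b c. B (Y a b c) u" "\<lambda>a b c. B (Y a b c) v" "\<lambda>a b c. B (Y a b c) w"])
    show "\<exists>m. x = of_nat m" for x :: "'p mod_ring"
      using surj_of_nat_mod_ring by blast
    show "a * B (Y a b c) u + b * B (Y a b c) v + c * B (Y a b c) w = 1" if "(a, b, c) \<noteq> (0, 0, 0)" for a b c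
      using B_Y[OF Yc Y0[OF that], of a b c] B_self[OF Yc Y0[OF that]] by simp
    show "a * B (Y a' b' c') u + b * B (Y a' b' c') v + c * B (Y a' b' c') w = 0"
      if "(a, b, c) \<noteq> (0, 0, 0)" "(a', b', c') \<noteq> (0, 0, 0)"
        "a' * B (Y a b c) u + b' * B (Y a b c) v + c' * B (Y a b c) w = 0" for a b c a' b' c'
      using B_sym[OF Yc Y0[OF that(1)] Yc Y0[OF that(2)]] B_Y[OF Yc Y0[OF that(1)]]
        B_Y[OF Yc Y0[OF that(2)]] that(3) by simp
    show "B (Y a (b / d) c) u = B (Y a b c) u" if "(a, b, c) \<noteq> (0, 0, 0)" for a b c
      using B_turn[OF that u(1)] B_orth by simp
    show "B (Y a (b / d) c) v = d * B (Y a b c) v" if "(a, b, c) \<noteq> (0, 0, 0)" for a b c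
      using B_turn[OF that v(1)] B_self[OF v(1,2)] by (simp add: algebra_simps)
  qed (use two d B_orth in \<open>simp_all add: basis_Y\<close>)
qed

lemma center_has_transvection:
  assumes "u \<in> carrier_vec n" "u \<noteq> 0\<^sub>v n"
  shows "\<exists>\<phi>. T u \<phi> \<and> \<phi> \<noteq> 0\<^sub>v n"
proof (rule ccontr)
  assume no: "\<not> ?thesis"
  obtain v \<phi> where v: "T v \<phi>" "v \<noteq> 0\<^sub>v n" "\<phi> \<noteq> 0\<^sub>v n" using exists_transvection by auto
  note c = T_carrier[OF v(1)]
  have zero: "\<psi> = 0\<^sub>v n" if "T u \<psi>" for \<psi> using no that by blast
  have "T v (0 \<cdot>\<^sub>v \<phi>)" by (rule T_smult_axis[OF v(1)])
  moreover have "0 \<cdot>\<^sub>v \<phi> = 0\<^sub>v n" using c by auto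
  ultimately have "T v \<psi>" if "T u \<psi>" for \<psi> using zero[OF that] by simp
  then have "T u \<phi>" using T_mono_eq[of v u \<phi>] assms v c by blast
  then show False using zero v(3) by blast
qed

text \<open>
  The homology fixes \<open>v\<close> and moves the axis of \<open>1 + v \<phi>\<close> by a multiple of \<open>\<psi>\<close>, so the commutator of the
  two maps is a transvection with centre \<open>v\<close> and axis \<open>\<psi>\<close>. Dually for the next lemma.
\<close>
lemma T_axisI:
  assumes "R u \<psi>" "T v \<phi>" "\<psi> \<bullet> v = 0" "\<phi> \<bullet> u \<noteq> 0"
  shows "T v \<psi>"
proof -
  note c = R_carrier[OF assms(1)] T_carrier[OF assms(2)]
  have "v - (\<psi> \<bullet> v / d) \<cdot>\<^sub>v u = v" using c assms(3) by auto
  then have "T v (\<phi> + (\<phi> \<bullet> u) \<cdot>\<^sub>v \<psi>)" using T_conj[OF assms(1,2)] by simp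
  from T_add_axis[OF this T_smult_axis[OF assms(2), of "- 1"]]
  have "T v (1 / (\<phi> \<bullet> u) \<cdot>\<^sub>v (\<phi> + (\<phi> \<bullet> u) \<cdot>\<^sub>v \<psi> + - 1 \<cdot>\<^sub>v \<phi>))" by (rule T_smult_axis)
  also have "1 / (\<phi> \<bullet> u) \<cdot>\<^sub>v (\<phi> + (\<phi> \<bullet> u) \<cdot>\<^sub>v \<psi> + - 1 \<cdot>\<^sub>v \<phi>) = \<psi>"
    using c assms(4) by (intro eq_vecI) auto
  finally show ?thesis .
qed

lemma T_centerI:
  assumes "R u \<psi>" "T v \<phi>" "\<phi> \<bullet> u = 0" "\<psi> \<bullet> v \<noteq> 0"
  shows "T u \<phi>"
proof -
  note c = R_carrier[OF assms(1)] T_carrier[OF assms(2)]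
  have "\<phi> + (\<phi> \<bullet> u) \<cdot>\<^sub>v \<psi> = \<phi>" using c assms(3) by auto
  then have "T (v - (\<psi> \<bullet> v / d) \<cdot>\<^sub>v u) \<phi>" using T_conj[OF assms(1,2)] by simp
  from T_add_center[OF this T_smult_center[OF assms(2), of "- 1"]]
  have "T ((- d / (\<psi> \<bullet> v)) \<cdot>\<^sub>v (v - (\<psi> \<bullet> v / d) \<cdot>\<^sub>v u + - 1 \<cdot>\<^sub>v v)) \<phi>" by (rule T_smult_center)
  also have "(- d / (\<psi> \<bullet> v)) \<cdot>\<^sub>v (v - (\<psi> \<bullet> v / d) \<cdot>\<^sub>v u + - 1 \<cdot>\<^sub>v v) = u"
    using c assms(4) d by (intro eq_vecI) auto
  finally show ?thesis .
qed

text \<open>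
  Let \<open>\<phi>'\<close> be the axis of a transvection with centre \<open>u\<close>. If the claim failed, some \<open>v\<close> in the kernel of
  \<open>\<psi>\<close> would violate it while \<open>\<phi>'(v) \<noteq> 0\<close>, because two proper subspaces cannot cover that kernel. For a
  transvection \<open>1 + v \<phi>\<close>, \<open>T_axisI\<close> forces \<open>\<phi>(u) = 0\<close>, and \<open>T_centerI\<close>, applied to the homology
  \<open>1 + u (\<psi> + \<phi>')\<close>, then makes \<open>\<phi>\<close> an axis for the centre \<open>u\<close> too. So \<open>v\<close> and \<open>u\<close> have the same axes;
  but \<open>\<phi>'\<close> is an axis for \<open>u\<close> and does not vanish at \<open>v\<close>.
\<close>
lemma T_homology_axis:
  assumes R: "R u \<psi>" and v0: "v0 \<in> carrier_vec n" "\<psi> \<bullet> v0 = 0"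
  shows "T v0 \<psi>"
proof (rule ccontr)
  assume not: "\<not> T v0 \<psi>"
  note c = R_carrier[OF R]
  obtain \<phi>' where \<phi>': "T u \<phi>'" "\<phi>' \<noteq> 0\<^sub>v n" using center_has_transvection c R_nonzero[OF R] by blast
  note c' = T_carrier[OF \<phi>'(1)]
  obtain i where i: "i < n" "\<phi>' $ i \<noteq> 0"
    using \<phi>' c' by (metis carrier_vecD eq_vecI index_zero_vec)
  define x where "x = (unit_vec n i :: 'p mod_ring vec)"
  have x: "x \<in> carrier_vec n" "\<phi>' \<bullet> x \<noteq> 0" using i c' by (auto simp: x_def)
  \<comment> \<open>The projection of \<open>x\<close> to the kernel of \<open>\<psi>\<close> along \<open>u\<close>; it keeps the value of \<open>\<phi>'\<close>, since \<open>\<phi>'(u) = 0\<close>.\<close>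
  define b where "b = x - (\<psi> \<bullet> x / (d - 1)) \<cdot>\<^sub>v u"
  have b: "b \<in> carrier_vec n" "\<psi> \<bullet> b = 0" "\<phi>' \<bullet> b \<noteq> 0"
    using c c' x d1 by (auto simp: b_def scalar_prod_minus_distrib[of _ n])
  have "\<exists>v\<in>carrier_vec n. \<psi> \<bullet> v = 0 \<and> \<not> T v \<psi> \<and> \<phi>' \<bullet> v \<noteq> 0"
  proof (cases "\<phi>' \<bullet> v0 \<noteq> 0 \<or> \<not> T b \<psi>")
    case True
    then show ?thesis using b v0 not by auto
  next
    case False
    have "\<not> T (v0 + b) \<psi>"
    proof
      assume "T (v0 + b) \<psi>"
      from T_add_center[OF this T_smult_center[of b \<psi> "- 1"]] False
      have "T (v0 + b + - 1 \<cdot>\<^sub>v b) \<psi>" by simp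
      also have "v0 + b + - 1 \<cdot>\<^sub>v b = v0" using b v0 by (intro eq_vecI) auto
      finally show False using not by simp
    qed
    moreover have "\<psi> \<bullet> (v0 + b) = 0" "\<phi>' \<bullet> (v0 + b) \<noteq> 0"
      using c c' b v0 False by (auto simp: scalar_prod_add_distrib[of _ n])
    ultimately show ?thesis using b v0 by (intro bexI[of _ "v0 + b"]) auto
  qed
  then obtain v where v: "v \<in> carrier_vec n" "\<psi> \<bullet> v = 0" "\<not> T v \<psi>" "\<phi>' \<bullet> v \<noteq> 0" by auto
  have vn: "v \<noteq> 0\<^sub>v n" using v c' by auto
  have R': "R u (\<psi> + \<phi>')" by (rule R_add[OF R \<phi>'(1)])
  have "T u \<phi>" if \<phi>: "T v \<phi>" for \<phi>
  proof -
    have "\<phi> \<bullet> u = 0" using T_axisI[OF R \<phi> v(2)] v(3) by blast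
    moreover have "(\<psi> + \<phi>') \<bullet> v \<noteq> 0" using v c c' by (simp add: add_scalar_prod_distrib[of _ n])
    ultimately show ?thesis by (intro T_centerI[OF R' \<phi>])
  qed
  then have "T v \<phi>'" using T_mono_eq[OF _ R_nonzero(1)[OF R] v(1) vn _ \<phi>'(1)] c by blast
  then show False using T_carrier v(4) by blast
qed

theorem all_transvections:
  assumes "v \<in> carrier_vec n" "\<phi> \<in> carrier_vec n" "\<phi> \<noteq> 0\<^sub>v n" "\<phi> \<bullet> v = 0"
  shows "T v \<phi>"
  using R_axis T_homology_axis assms by blast

end

section \<open>Rank one perturbations of the identity\<close>

definition rank_one :: "nat \<Rightarrow> 'a::comm_ring_1 vec \<Rightarrow> 'a vec \<Rightarrow> 'a mat" where
  "rank_one n v \<phi> = 1\<^sub>m n + mat n n (\<lambda>(i, j). v $ i * \<phi> $ j)"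

lemma rank_one_carrier [simp]: "rank_one n v \<phi> \<in> carrier_mat n n"
  by (simp add: rank_one_def)

lemma rank_one_mult_vec:
  fixes x :: "'a::comm_ring_1 vec"
  assumes "v \<in> carrier_vec n" "\<phi> \<in> carrier_vec n" "x \<in> carrier_vec n"
  shows "rank_one n v \<phi> *\<^sub>v x = x + (\<phi> \<bullet> x) \<cdot>\<^sub>v v"
proof -
  have "mat n n (\<lambda>(i, j). v $ i * \<phi> $ j) *\<^sub>v x = (\<phi> \<bullet> x) \<cdot>\<^sub>v v"
    using assms by (intro eq_vecI) (auto simp: scalar_prod_def sum_distrib_left sum_distrib_right ac_simps)
  then show ?thesis using assms by (simp add: rank_one_def add_mult_distrib_mat_vec[of _ n n])
qed

lemma mat_eq_by_action:
  fixes A B :: "'a::semiring_1 mat"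
  assumes "A \<in> carrier_mat n n" "B \<in> carrier_mat n n"
    and "\<And>x. x \<in> carrier_vec n \<Longrightarrow> A *\<^sub>v x = B *\<^sub>v x"
  shows "A = B"
proof (rule eq_matI)
  fix i j assume ij: "i < dim_row B" "j < dim_col B"
  have "(A *\<^sub>v unit_vec n j) $ i = (B *\<^sub>v unit_vec n j) $ i" using assms(3) by simp
  then show "A $$ (i, j) = B $$ (i, j)" using assms(1,2) ij by simp
qed (use assms in auto)

text \<open>
  Composition adds the forms up to a correction that vanishes for transvections. The same formula
  yields inverses of homologies, quotients of homologies with a common centre, and powers.
\<close>
lemma rank_one_mult_same_center:
  fixes \<alpha> \<beta> :: "'a::comm_ring_1 vec"
  assumes c: "u \<in> carrier_vec n" "\<alpha> \<in> carrier_vec n" "\<beta> \<in> carrier_vec n"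
  shows "rank_one n u \<alpha> * rank_one n u \<beta> = rank_one n u (\<alpha> + \<beta> + (\<alpha> \<bullet> u) \<cdot>\<^sub>v \<beta>)"
proof (rule mat_eq_by_action[of _ n])
  fix x :: "'a vec" assume x: "x \<in> carrier_vec n"
  have "\<alpha> \<bullet> (x + (\<beta> \<bullet> x) \<cdot>\<^sub>v u) = \<alpha> \<bullet> x + (\<beta> \<bullet> x) * (\<alpha> \<bullet> u)"
    using c x by (simp add: scalar_prod_add_distrib[of _ n])
  moreover have "(\<alpha> + \<beta> + (\<alpha> \<bullet> u) \<cdot>\<^sub>v \<beta>) \<bullet> x = \<alpha> \<bullet> x + \<beta> \<bullet> x + (\<alpha> \<bullet> u) * (\<beta> \<bullet> x)"
    using c x by (simp add: add_scalar_prod_distrib[of _ n])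
  ultimately show "rank_one n u \<alpha> * rank_one n u \<beta> *\<^sub>v x = rank_one n u (\<alpha> + \<beta> + (\<alpha> \<bullet> u) \<cdot>\<^sub>v \<beta>) *\<^sub>v x"
    using c x by (simp add: rank_one_mult_vec assoc_mult_mat_vec[of _ n n _ n])
      (intro eq_vecI, auto simp: algebra_simps)
qed (auto intro!: mult_carrier_mat[of _ n n])

lemma rank_one_mult_same_axis:
  fixes \<phi> :: "'a::comm_ring_1 vec"
  assumes c: "u \<in> carrier_vec n" "v \<in> carrier_vec n" "\<phi> \<in> carrier_vec n" "\<phi> \<bullet> v = 0"
  shows "rank_one n u \<phi> * rank_one n v \<phi> = rank_one n (u + v) \<phi>"
proof (rule mat_eq_by_action[of _ n])
  fix x :: "'a vec" assume x: "x \<in> carrier_vec n"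
  have "\<phi> \<bullet> (x + (\<phi> \<bullet> x) \<cdot>\<^sub>v v) = \<phi> \<bullet> x"
    using c x by (simp add: scalar_prod_add_distrib[of _ n])
  then show "rank_one n u \<phi> * rank_one n v \<phi> *\<^sub>v x = rank_one n (u + v) \<phi> *\<^sub>v x"
    using c x by (simp add: rank_one_mult_vec assoc_mult_mat_vec[of _ n n _ n])
      (intro eq_vecI, auto simp: algebra_simps)
qed (auto intro!: mult_carrier_mat[of _ n n])

lemma rank_one_smult:
  assumes "v \<in> carrier_vec n" "\<phi> \<in> carrier_vec n"
  shows "rank_one n (c \<cdot>\<^sub>v v) \<phi> = rank_one n v (c \<cdot>\<^sub>v \<phi>)"
  unfolding rank_one_def using assms by (intro arg_cong2[of _ _ _ _ "(+)"] eq_matI) auto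

lemma rank_one_zero: "rank_one n v (0\<^sub>v n) = 1\<^sub>m n"
  unfolding rank_one_def by (intro eq_matI) auto

text \<open>
  The row vector of the form is multiplied by \<open>h\<close> from the right, hence the transpose.
\<close>
lemma rank_one_conj:
  fixes g h :: "'a::field mat"
  assumes c: "v \<in> carrier_vec n" "\<phi> \<in> carrier_vec n" "g \<in> carrier_mat n n" "h \<in> carrier_mat n n"
    and gh: "g * h = 1\<^sub>m n"
  shows "g * rank_one n v \<phi> * h = rank_one n (g *\<^sub>v v) (h\<^sup>T *\<^sub>v \<phi>)"
proof (rule mat_eq_by_action[of _ n])
  fix x :: "'a vec" assume x: "x \<in> carrier_vec n"
  have hx: "h *\<^sub>v x \<in> carrier_vec n" using c x by simp
  have "g *\<^sub>v (h *\<^sub>v x) = x" using c x gh by (metis assoc_mult_mat_vec one_mult_mat_vec)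
  moreover have "(h\<^sup>T *\<^sub>v \<phi>) \<bullet> x = \<phi> \<bullet> (h *\<^sub>v x)"
    using c x by (intro transpose_vec_mult_scalar) auto
  ultimately show "g * rank_one n v \<phi> * h *\<^sub>v x = rank_one n (g *\<^sub>v v) (h\<^sup>T *\<^sub>v \<phi>) *\<^sub>v x"
    using c x hx by (simp add: rank_one_mult_vec assoc_mult_mat_vec[of _ n n _ n] mult_carrier_mat[of _ n n]
        mult_add_distrib_mat_vec[of _ n n] mult_mat_vec)
qed (use c in \<open>auto intro!: mult_carrier_mat[of _ n n]\<close>)

section \<open>Transvections generate the special linear group\<close>

lemma GL_simps:
  "carrier (GL TYPE('a::field) n) = {A \<in> carrier_mat n n. det A \<noteq> 0}"
  "monoid.mult (GL TYPE('a) n) = (*)" "monoid.one (GL TYPE('a) n) = 1\<^sub>m n"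
proof -
  have "A \<in> carrier_mat n n" if "A \<in> Units (ring_mat TYPE('a) n ())" for A
    using that by (auto simp: Units_def ring_mat_simps)
  then show "carrier (GL TYPE('a) n) = {A \<in> carrier_mat n n. det A \<noteq> 0}"
    using unit_imp_det_non_zero[of _ n "()"] det_non_zero_imp_unit[of _ n "()"]
    by (auto simp: GL_def units_of_carrier)
qed (simp_all add: GL_def units_of_mult units_of_one ring_mat_simps)

lemma group_GL: "group (GL TYPE('a::field) n)"
proof -
  interpret ring "ring_mat TYPE('a) n ()" by (rule ring_mat)
  show ?thesis unfolding GL_def by (rule units_group)
qed

text \<open>
  The \<open>p\<close>-th power of a transvection is the identity, and \<open>x ^ p = x\<close> in \<open>F_p\<close>.
\<close>
lemma det_transvection:
  fixes v \<phi> :: "'p::prime_card mod_ring vec"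
  assumes c: "v \<in> carrier_vec n" "\<phi> \<in> carrier_vec n" "\<phi> \<bullet> v = 0"
  shows "det (rank_one n v \<phi>) = 1"
proof -
  let ?t = "rank_one n v \<phi>"
  have pow: "det ?t ^ m = det (rank_one n v (of_nat m \<cdot>\<^sub>v \<phi>))" for m
  proof (induction m)
    case 0
    have "of_nat 0 \<cdot>\<^sub>v \<phi> = 0\<^sub>v n" using c by auto
    then show ?case by (simp add: rank_one_zero)
  next
    case (Suc m)
    have "rank_one n v \<phi> * rank_one n v (of_nat m \<cdot>\<^sub>v \<phi>) = rank_one n v (of_nat (Suc m) \<cdot>\<^sub>v \<phi>)"
      using c by (subst rank_one_mult_same_center)
        (auto intro!: arg_cong[of _ _ "rank_one n v"] simp: algebra_simps)
    then show ?case using Suc det_mult[of ?t n "rank_one n v (of_nat m \<cdot>\<^sub>v \<phi>)"] by simp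
  qed
  have "det ?t = det ?t ^ CARD('p)" using finite_field_power_card_eq_same[of "det ?t"] by simp
  also have "\<dots> = det (rank_one n v (0 \<cdot>\<^sub>v \<phi>))" unfolding pow by simp
  also have "0 \<cdot>\<^sub>v \<phi> = 0\<^sub>v n" using c by auto
  finally show ?thesis by (simp add: rank_one_zero)
qed

lemma fixed_columns_mult_vec:
  fixes B :: "'a::comm_ring_1 mat" and y :: "'a vec"
  assumes B: "B \<in> carrier_mat n n" "\<And>j. j < k \<Longrightarrow> col B j = unit_vec n j"
    and y: "y \<in> carrier_vec n" "\<And>j. k \<le> j \<Longrightarrow> j < n \<Longrightarrow> y $ j = 0" and k: "k \<le> n"
  shows "B *\<^sub>v y = y"
proof (rule eq_vecI)
  fix i assume i: "i < dim_vec y"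
  have "B $$ (i, j) * y $ j = (if i = j then y $ j else 0)" if "j < n" for j
  proof (cases "j < k")
    case True
    then have "B $$ (i, j) = unit_vec n j $ i" using B i y that by (metis carrier_matD carrier_vecD index_col)
    then show ?thesis using i y that by auto
  qed (use y that in auto)
  then have "(B *\<^sub>v y) $ i = (\<Sum>j<n. if i = j then y $ j else 0)"
    using B(1) i y(1) by (auto simp: scalar_prod_def lessThan_atLeast0 intro!: sum.cong)
  then show "(B *\<^sub>v y) $ i = y $ i" using i y(1) by simp
qed (use B y in auto)

text \<open>
  With a nonzero entry at a position \<open>j\<close> below the diagonal there is a form \<open>\<phi>\<close> supported on the
  coordinates \<open>k\<close> and \<open>j\<close> that takes the value 1 both at the column \<open>w\<close> and at \<open>e_k\<close>. The transvection
  \<open>1 + (e_k - w) \<phi>\<close> then maps \<open>w\<close> to \<open>e_k\<close>, and it fixes the earlier columns, where \<open>\<phi>\<close> vanishes.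
\<close>
lemma clear_column:
  fixes B :: "'a::field mat"
  assumes B: "B \<in> carrier_mat n n" "\<And>i. i < k \<Longrightarrow> col B i = unit_vec n i"
    and j: "k < j" "j < n" "B $$ (j, k) \<noteq> 0"
  shows "\<exists>v \<phi>. v \<in> carrier_vec n \<and> \<phi> \<in> carrier_vec n \<and> \<phi> \<bullet> v = 0 \<and>
    (\<forall>i<Suc k. col (rank_one n v \<phi> * B) i = unit_vec n i)"
proof -
  define w where "w = col B k"
  define c where "c = (1 - w $ k) / w $ j"
  define \<phi> where "\<phi> = unit_vec n k + c \<cdot>\<^sub>v unit_vec n j"
  define v where "v = unit_vec n k - w"
  have w: "w \<in> carrier_vec n" "w $ j \<noteq> 0" using B j by (auto simp: w_def)
  have c: "v \<in> carrier_vec n" "\<phi> \<in> carrier_vec n" using w by (auto simp: v_def \<phi>_def)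
  have \<phi>x: "\<phi> \<bullet> x = x $ k + c * x $ j" if "x \<in> carrier_vec n" for x
    using that j by (simp add: \<phi>_def add_scalar_prod_distrib[of _ n])
  have \<phi>w: "\<phi> \<bullet> w = 1" using \<phi>x[OF w(1)] w by (simp add: c_def)
  have "\<phi> \<bullet> v = \<phi> \<bullet> unit_vec n k - \<phi> \<bullet> w"
    using w c by (simp add: v_def scalar_prod_minus_distrib[of _ n])
  also have "\<phi> \<bullet> unit_vec n k = 1" using j by (subst \<phi>x) auto
  finally have "\<phi> \<bullet> v = 0" using \<phi>w by simp
  moreover have "col (rank_one n v \<phi> * B) i = unit_vec n i" if "i < Suc k" for i
  proof (cases "i = k")
    case True
    have "w + v = unit_vec n k" using w by (intro eq_vecI) (auto simp: v_def)
    moreover have "col (rank_one n v \<phi> * B) k = rank_one n v \<phi> *\<^sub>v w"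
      unfolding w_def using B(1) j by (intro col_mult2[of _ n n _ n]) auto
    ultimately show ?thesis using True c w \<phi>w by (simp add: rank_one_mult_vec)
  next
    case False
    then have i: "i < k" using that by simp
    have "\<phi> \<bullet> unit_vec n i = 0" using i j \<phi>x[of "unit_vec n i"] by simp
    moreover have "col (rank_one n v \<phi> * B) i = rank_one n v \<phi> *\<^sub>v col B i"
      using B(1) i j by (intro col_mult2[of _ n n _ n]) auto
    moreover have "unit_vec n i + 0 \<cdot>\<^sub>v v = unit_vec n i" using c by auto
    ultimately show ?thesis using B(2)[OF i] c by (simp add: rank_one_mult_vec)
  qed
  ultimately show ?thesis using c by blast
qed

text \<open>
  Otherwise the matrix fixes its own \<open>k\<close>-th column, which by injectivity would have to be \<open>e_k\<close>, although it
  vanishes from row \<open>k\<close> on.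
\<close>
lemma column_below_nonzero:
  fixes B :: "'a::field mat"
  assumes B: "B \<in> carrier_mat n n" "\<And>i. i < k \<Longrightarrow> col B i = unit_vec n i" "det B \<noteq> 0" and k: "k < n"
  shows "\<exists>j\<ge>k. j < n \<and> B $$ (j, k) \<noteq> 0"
proof (rule ccontr)
  assume no: "\<not> ?thesis"
  define x where "x = col B k - unit_vec n k"
  have y: "col B k \<in> carrier_vec n" using B by auto
  have "B *\<^sub>v col B k = col B k"
    by (rule fixed_columns_mult_vec[OF B(1,2) y, of k]) (use no B k in auto)
  moreover have "B *\<^sub>v unit_vec n k = col B k" using B k
    by (intro eq_vecI) auto
  ultimately have "B *\<^sub>v x = 0\<^sub>v n"
    using B y by (simp add: x_def mult_minus_distrib_mat_vec[of _ n n])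
  moreover have "x \<in> carrier_vec n" using y by (simp add: x_def)
  ultimately have "x = 0\<^sub>v n" using det_0_iff_vec_prod_zero_field[OF B(1)] B(3) by blast
  then have "x $ k = 0" using k by simp
  then show False using no k B by (simp add: x_def)
qed

lemma rank_one_of_fixed_columns:
  fixes B :: "'a::comm_ring_1 mat"
  assumes B: "B \<in> carrier_mat n n" "\<And>i. i < n - 1 \<Longrightarrow> col B i = unit_vec n i" and n: "n > 0"
  shows "B = rank_one n (col B (n - 1) - unit_vec n (n - 1)) (unit_vec n (n - 1))"
proof (rule eq_matI)
  fix i j assume "i < dim_row (rank_one n (col B (n - 1) - unit_vec n (n - 1)) (unit_vec n (n - 1)))"
    "j < dim_col (rank_one n (col B (n - 1) - unit_vec n (n - 1)) (unit_vec n (n - 1)))"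
  then have ij: "i < n" "j < n" by (auto simp: rank_one_def)
  show "B $$ (i, j) = rank_one n (col B (n - 1) - unit_vec n (n - 1)) (unit_vec n (n - 1)) $$ (i, j)"
  proof (cases "j = n - 1")
    case True
    then show ?thesis using ij B by (simp add: rank_one_def)
  next
    case False
    then have "B $$ (i, j) = unit_vec n j $ i" using B ij
      by (metis One_nat_def Suc_pred carrier_matD(1,2) index_col less_SucE n)
    then show ?thesis using ij False B by (simp add: rank_one_def)
  qed
qed (use B in \<open>auto simp: rank_one_def\<close>)

text \<open>
  Columns are reduced from left to right. If a column is zero below the diagonal, one transvection first
  copies its diagonal entry to the next row. After \<open>n - 1\<close> columns the matrix differs from the identity in
  its last column only, and determinant 1 makes it a transvection.
\<close>
theorem SL_generated_by_transvections:
  fixes A :: "'p::prime_card mod_ring mat"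
  assumes K: "subgroup K (GL TYPE('p mod_ring) n)" and n: "n > 0"
    and trans: "\<And>v \<phi>. v \<in> carrier_vec n \<Longrightarrow> \<phi> \<in> carrier_vec n \<Longrightarrow> \<phi> \<bullet> v = 0 \<Longrightarrow> rank_one n v \<phi> \<in> K"
    and A: "A \<in> carrier_mat n n" "det A = 1"
  shows "A \<in> K"
proof -
  let ?GL = "GL TYPE('p mod_ring) n"
  interpret group ?GL by (rule group_GL)
  interpret K: subgroup K ?GL by (rule K)
  have KM: "g \<in> carrier_mat n n" if "g \<in> K" for g using K.subset that by (auto simp: GL_simps)
  have Km: "g * h \<in> K" if "g \<in> K" "h \<in> K" for g h using K.m_closed[OF that] by (simp add: GL_simps)
  have "\<exists>h\<in>K. det h = 1 \<and> (\<forall>i<k. col (h * A) i = unit_vec n i)" if "k \<le> n - 1" for k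
    using that
  proof (induction k)
    case 0
    show ?case using K.one_closed by (intro bexI[of _ "1\<^sub>m n"]) (auto simp: GL_simps)
  next
    case (Suc k)
    then obtain h where h: "h \<in> K" "det h = 1" "\<And>i. i < k \<Longrightarrow> col (h * A) i = unit_vec n i" by auto
    define B where "B = h * A"
    have B: "B \<in> carrier_mat n n" "det B = 1" using h KM[OF h(1)] A by (auto simp: B_def det_mult)
    have kn: "k < n" "Suc k < n" using Suc.prems n by auto
    have finish: "?case" if h': "h' \<in> K" "det h' = 1" "\<And>i. i < k \<Longrightarrow> col (h' * A) i = unit_vec n i"
      and j: "k < j" "j < n" "(h' * A) $$ (j, k) \<noteq> 0" for h' j
    proof -
      have "h' * A \<in> carrier_mat n n" using KM[OF h'(1)] A by simp
      from clear_column[OF this h'(3) j] obtain v \<phi> where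
        v: "v \<in> carrier_vec n" "\<phi> \<in> carrier_vec n" "\<phi> \<bullet> v = 0"
          "\<forall>i<Suc k. col (rank_one n v \<phi> * (h' * A)) i = unit_vec n i" by blast
      have "rank_one n v \<phi> * (h' * A) = (rank_one n v \<phi> * h') * A"
        using KM[OF h'(1)] A by (simp add: assoc_mult_mat[of _ n n _ n _ n])
      moreover have "det (rank_one n v \<phi> * h') = 1"
        using det_transvection[OF v(1-3)] h'(2) KM[OF h'(1)] by (simp add: det_mult[of _ n])
      ultimately show ?thesis using v(4) Km[OF trans[OF v(1-3)] h'(1)] by auto
    qed
    show ?case
    proof (cases "\<exists>j>k. j < n \<and> B $$ (j, k) \<noteq> 0")
      case True
      then show ?thesis using finish[OF h] by (auto simp: B_def)
    next
      case False
      then have Bk: "B $$ (k, k) \<noteq> 0"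
        using column_below_nonzero[of B n k] B h kn unfolding B_def[symmetric]
        by (metis nat_less_le one_neq_zero)
      let ?e = "unit_vec n (Suc k) :: 'p mod_ring vec" and ?f = "unit_vec n k :: 'p mod_ring vec"
      have c: "?e \<in> carrier_vec n" "?f \<in> carrier_vec n" "?f \<bullet> ?e = 0" using kn by auto
      let ?t = "rank_one n ?e ?f"
      have tB: "col (?t * B) i = col B i + (B $$ (k, i)) \<cdot>\<^sub>v ?e" if "i < n" for i
      proof -
        have "col (?t * B) i = ?t *\<^sub>v col B i" using B that by (intro col_mult2[of _ n n _ n]) auto
        then show ?thesis using B kn that c by (simp add: rank_one_mult_vec)
      qed
      have th: "?t * h * A = ?t * B" using KM[OF h(1)] A by (simp add: B_def assoc_mult_mat[of _ n n _ n _ n])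
      show ?thesis
      proof (rule finish[of "?t * h" "Suc k"])
        show "?t * h \<in> K" using Km trans c h by blast
        show "det (?t * h) = 1" using det_transvection[OF c] h KM[OF h(1)] by (simp add: det_mult[of _ n])
        show "col (?t * h * A) i = unit_vec n i" if i: "i < k" for i
        proof -
          have cB: "col B i = unit_vec n i" using h(3)[OF i] by (simp add: B_def)
          have "B $$ (k, i) = col B i $ k" using B kn i by simp
          then have "B $$ (k, i) = 0" using cB kn i by simp
          moreover have "unit_vec n i + 0 \<cdot>\<^sub>v ?e = unit_vec n i" by auto
          ultimately show ?thesis unfolding th using tB[of i] cB i kn by simp
        qed
        have "(?t * B) $$ (Suc k, k) = col (?t * B) k $ Suc k" using B kn
          by (metis rank_one_carrier carrier_matD index_col index_mult_mat(2,3))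
        also have "\<dots> = B $$ (Suc k, k) + B $$ (k, k)"
          using tB[OF kn(1)] kn B by simp
        also have "\<dots> \<noteq> 0" using False Bk kn by auto
        finally show "(?t * h * A) $$ (Suc k, k) \<noteq> 0" unfolding th .
      qed (use kn in auto)
    qed
  qed
  from this[OF order_refl] obtain h where h: "h \<in> K" "det h = 1"
    "\<And>i. i < n - 1 \<Longrightarrow> col (h * A) i = unit_vec n i" by auto
  define B where "B = h * A"
  have B: "B \<in> carrier_mat n n" "det B = 1" using h KM[OF h(1)] A by (auto simp: B_def det_mult)
  have colB: "col B i = unit_vec n i" if "i < n - 1" for i using h(3) that by (simp add: B_def)
  let ?w = "col B (n - 1) - unit_vec n (n - 1)"
  have entry: "B $$ (i, j) = (if i = j then 1 else 0)" if "i < n" "j < n - 1" for i j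
  proof -
    have "B $$ (i, j) = col B j $ i" using that B by simp
    then show ?thesis using colB that by simp
  qed
  have "det B = prod_list (diag_mat B)"
    by (rule det_upper_triangular[OF _ B(1)]) (use entry B in \<open>auto simp: upper_triangular_def\<close>)
  also have "\<dots> = (\<Prod>i<n. B $$ (i, i))" using B by (simp add: prod_list_diag_prod lessThan_atLeast0)
  also have "\<dots> = B $$ (n - 1, n - 1) * (\<Prod>i<n-1. B $$ (i, i))"
    using n by (cases n) (simp_all add: lessThan_Suc mult.commute)
  also have "(\<Prod>i<n-1. B $$ (i, i)) = 1" using entry by (intro prod.neutral) auto
  finally have "B $$ (n - 1, n - 1) = 1" using B by simp
  moreover have "?w \<in> carrier_vec n" using B n by auto
  ultimately have "unit_vec n (n - 1) \<bullet> ?w = 0" using B n by (subst scalar_prod_left_unit) auto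
  then have "rank_one n ?w (unit_vec n (n - 1)) \<in> K" using B(1) n by (intro trans) auto
  then have "B \<in> K" using rank_one_of_fixed_columns[OF B(1) colB n] by simp
  then have *: "inv\<^bsub>?GL\<^esub> h \<otimes>\<^bsub>?GL\<^esub> (h \<otimes>\<^bsub>?GL\<^esub> A) \<in> K"
    using K.m_closed[OF K.m_inv_closed[OF h(1)], of B] by (simp add: GL_simps(2) B_def)
  have "A \<in> carrier ?GL" "h \<in> carrier ?GL" using A h K.subset by (auto simp: GL_simps)
  then have "inv\<^bsub>?GL\<^esub> h \<otimes>\<^bsub>?GL\<^esub> (h \<otimes>\<^bsub>?GL\<^esub> A) = A"
    by (simp add: m_assoc[symmetric])
  then show ?thesis using * by simp
qed

section \<open>The companion matrix of a primitive polynomial\<close>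

text \<open>
  Of the field \<open>K\<close> only the count survives: the powers of \<open>x\<close> make up \<open>p^n - 1\<close> elements.
\<close>
lemma primitive_poly_root:
  fixes f :: "'p::prime_card mod_ring poly"
  assumes "primitive_poly f"
  obtains x where "x \<noteq> 0" "is_minimal_poly f x"
    "\<And>m. m > 0 \<Longrightarrow> x ^ m = 1 \<Longrightarrow> CARD('p) ^ Polynomial.degree f - 1 \<le> m"
proof -
  obtain K :: "'p mod_ring alg_closure set" and x where
    K: "card K = CARD('p) ^ Polynomial.degree f" "K - {0} = range (\<lambda>k::int. x powi k)"
      and min: "is_minimal_poly f x"
    using assms unfolding primitive_poly_def by (elim exE conjE)
  have "x powi 1 \<in> K - {0}" unfolding K(2) by (rule rangeI)
  then have x0: "x \<noteq> 0" by simp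
  have "CARD('p) ^ Polynomial.degree f - 1 \<le> m" if m: "m > 0" "x ^ m = 1" for m
  proof -
    have "x powi k \<in> (\<lambda>i. x ^ i) ` {..<m}" for k
    proof -
      have "x powi (int m * (k div int m) + k mod int m) = x powi (int m * (k div int m)) * x powi (k mod int m)"
        using x0 by (intro power_int_add) simp
      then have "x powi k = x powi (int m * (k div int m)) * x powi (k mod int m)"
        unfolding mult_div_mod_eq .
      also have "x powi (int m * (k div int m)) = 1" using m by (simp add: power_int_mult)
      also have "x powi (k mod int m) = x ^ nat (k mod int m)"
        using m by (simp add: power_int_def)
      finally have "x powi k = x ^ nat (k mod int m)" by simp
      moreover have "nat (k mod int m) < m" using m by (simp add: nat_less_iff)
      ultimately show ?thesis by blast
    qed
    then have "K - {0} \<subseteq> (\<lambda>i. x ^ i) ` {..<m}" unfolding K(2) by blast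
    then have "card (K - {0}) \<le> m" using surj_card_le[of "{..<m}" "K - {0}"] by simp
    moreover have "card K - 1 \<le> card (K - {0})" using diff_card_le_card_Diff[of "{0}" K] by simp
    ultimately show ?thesis using K(1) by simp
  qed
  then show thesis using that x0 min by blast
qed

lemma inj_on_lessThanI:
  fixes m :: nat
  assumes "\<And>i j. i < j \<Longrightarrow> j < m \<Longrightarrow> g i \<noteq> g j"
  shows "inj_on g {..<m}"
  by (rule linorder_inj_onI) (use assms in auto)

lemma card_carrier_vec:
  "card (carrier_vec n :: 'a::finite vec set) = CARD('a) ^ n" "finite (carrier_vec n :: 'a vec set)"
proof -
  let ?L = "{xs :: 'a list. set xs \<subseteq> UNIV \<and> length xs = n}"
  have inj: "inj_on vec_of_list ?L" by (rule inj_onI) (metis list_vec)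
  have eq: "carrier_vec n = vec_of_list ` ?L"
  proof
    show "carrier_vec n \<subseteq> vec_of_list ` ?L"
    proof
      fix v :: "'a vec" assume "v \<in> carrier_vec n"
      then have "list_of_vec v \<in> ?L" by simp
      then show "v \<in> vec_of_list ` ?L" by (metis imageI vec_list)
    qed
  qed (auto intro: carrier_vecI)
  show "card (carrier_vec n :: 'a vec set) = CARD('a) ^ n"
    unfolding eq card_image[OF inj] by (rule card_lists_length_eq) simp
  show "finite (carrier_vec n :: 'a vec set)"
    unfolding eq by (intro finite_imageI finite_lists_length_eq) simp
qed

lemma companion_mat_carrier: "companion_mat f \<in> carrier_mat (Polynomial.degree f) (Polynomial.degree f)"
  by (simp add: companion_mat_def Let_def)

lemma det_companion_mat:
  fixes f :: "'a::comm_ring_1 poly"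
  assumes "Polynomial.degree f = n" "n > 0"
  shows "det (companion_mat f) = (- 1) ^ n * Polynomial.coeff f 0"
proof -
  let ?C = "companion_mat f"
  have C: "?C \<in> carrier_mat n n" using companion_mat_carrier[of f] assms by simp
  have entry: "?C $$ (i, j) = (if j = n - 1 then - Polynomial.coeff f i else if i = j + 1 then 1 else 0)"
    if "i < n" "j < n" for i j using that assms by (simp add: companion_mat_def)
  have "det ?C = (\<Sum>j<n. ?C $$ (0, j) * cofactor ?C 0 j)"
    using assms by (intro laplace_expansion_row[OF C]) auto
  also have "\<dots> = (\<Sum>j<n. if j = n - 1 then - Polynomial.coeff f 0 * cofactor ?C 0 (n - 1) else 0)"
    using assms by (intro sum.cong) (auto simp: entry)
  also have "\<dots> = - Polynomial.coeff f 0 * cofactor ?C 0 (n - 1)" using assms by simp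
  also have "cofactor ?C 0 (n - 1) = (- 1) ^ (n - 1) * det (mat_delete ?C 0 (n - 1))"
    by (simp add: cofactor_def)
  also have "mat_delete ?C 0 (n - 1) = 1\<^sub>m (n - 1)"
    using C by (intro eq_matI) (auto simp: mat_delete_def entry)
  also have "(- 1) ^ (n - 1) * det (1\<^sub>m (n - 1) :: 'a mat) = (- 1) ^ (n - 1)" by simp
  also have "- Polynomial.coeff f 0 * (- 1) ^ (n - 1) = (- 1) ^ n * Polynomial.coeff f 0"
    using assms by (cases n) auto
  finally show ?thesis .
qed

text \<open>
  The difference of the two sides has smaller degree, and all elements of \<open>A\<close> are roots of it.
\<close>
lemma monic_eq_prod_roots:
  fixes q :: "'a::field poly"
  assumes q: "Polynomial.lead_coeff q = 1" "Polynomial.degree q = card A" and A: "finite A"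
    and roots: "\<And>y. y \<in> A \<Longrightarrow> poly q y = 0"
  shows "q = (\<Prod>y\<in>A. [:- y, 1:])"
proof (rule ccontr)
  let ?r = "\<Prod>y\<in>A. [:- y, 1:]"
  assume ne: "q \<noteq> ?r"
  have deg: "Polynomial.degree ?r = card A" by (subst degree_prod_eq_sum_degree) auto
  have lead: "Polynomial.lead_coeff ?r = 1" by (subst lead_coeff_prod) simp
  have "card A \<le> card {y. poly (q - ?r) y = 0}"
    using A roots ne by (intro card_mono poly_roots_finite) (auto simp: poly_prod)
  also have "\<dots> \<le> Polynomial.degree (q - ?r)" using ne by (intro card_poly_roots_bound) simp
  finally have "card A \<le> Polynomial.degree (q - ?r)" .
  moreover have "Polynomial.degree (q - ?r) \<le> card A"
    using q deg by (intro degree_diff_le) auto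
  ultimately have "Polynomial.degree (q - ?r) = card A" by simp
  then have "Polynomial.lead_coeff (q - ?r) = 0" using q deg lead by simp
  then have "q - ?r = 0" by (simp only: leading_coeff_0_iff)
  then show False using ne by simp
qed

lemma poly_map_to_ac_frobenius:
  fixes g :: "'p::prime_card mod_ring poly"
  shows "poly (map_poly to_ac g) (x ^ CARD('p) ^ i) = poly (map_poly to_ac g) x ^ CARD('p) ^ i"
proof -
  have pw: "a ^ CARD('p) ^ i = a" for a :: "'p mod_ring"
    using finite_field_power_card_power_eq_same[of "CARD('p) ^ i" i a] by simp
  have "poly (map_poly to_ac g) x ^ CARD('p) ^ i =
      (\<Sum>j\<le>Polynomial.degree (map_poly to_ac g). (Polynomial.coeff (map_poly to_ac g) j * x ^ j) ^ CARD('p) ^ i)"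
    unfolding poly_altdef by (rule freshmans_dream_sum') (use prime_card in auto)
  also have "\<dots> = (\<Sum>j\<le>Polynomial.degree (map_poly to_ac g). Polynomial.coeff (map_poly to_ac g) j * (x ^ CARD('p) ^ i) ^ j)"
    by (intro sum.cong refl) (simp add: coeff_map_poly power_mult_distrib pw mult.commute flip: to_ac_power power_mult)
  finally show ?thesis by (simp add: poly_altdef)
qed

lemma power_diff_eq_one:
  fixes y :: "'a::field"
  assumes "y \<noteq> 0" "i < j" "y ^ i = y ^ j"
  shows "y ^ (j - i) = 1"
proof -
  have "y ^ j = y ^ i * y ^ (j - i)" using assms(2) by (simp flip: power_add)
  then have "y ^ i * y ^ (j - i) = y ^ i * 1" using assms(3) by (metis mult.right_neutral)
  moreover have "y ^ i \<noteq> 0" using assms(1) by simp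
  ultimately show ?thesis using mult_left_cancel by blast
qed

lemma power_minus_one_nat:
  fixes q :: nat
  assumes "q \<ge> 1"
  shows "q ^ n - 1 = (q - 1) * (\<Sum>i<n. q ^ i)"
proof -
  obtain r where r: "q = Suc r" using assms by (cases q) auto
  have "Suc r ^ n = r * (\<Sum>i<n. Suc r ^ i) + 1"
    by (induction n) (simp_all add: algebra_simps)
  then show ?thesis unfolding r by simp
qed

lemma power_gap:
  fixes q :: nat
  assumes "q \<ge> 2" "i < j" "j < n"
  shows "q ^ i < q ^ j" "q ^ j - q ^ i < q ^ n - 1"
proof -
  show *: "q ^ i < q ^ j" using assms by (intro power_strict_increasing) auto
  have "q ^ j < q ^ n" using assms by (intro power_strict_increasing) auto
  moreover have "q ^ i > 0" using assms by simp
  ultimately show "q ^ j - q ^ i < q ^ n - 1" using * by linarith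
qed

text \<open>
  The lower bound on the order of \<open>x\<close> makes its powers below \<open>p^n - 1\<close> distinct, so that they exhaust the
  nonzero elements of the field generated by \<open>x\<close>.
\<close>
locale singer_cycle =
  fixes f :: "'p::prime_card mod_ring poly" and n :: nat and x :: "'p mod_ring alg_closure"
  assumes deg: "Polynomial.degree f = n" and n: "n > 0" and x0: "x \<noteq> 0"
    and min: "is_minimal_poly f x"
    and ord: "\<And>m. m > 0 \<Longrightarrow> x ^ m = 1 \<Longrightarrow> CARD('p) ^ n - 1 \<le> m"
begin

abbreviation "C \<equiv> companion_mat f"

lemma C [simp]: "C \<in> carrier_mat n n"
  using companion_mat_carrier[of f] deg by simp

lemma C_pow [simp]: "C ^\<^sub>m i \<in> carrier_mat n n"
  by (simp add: pow_carrier_mat)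

lemma x_pow_eq_gap:
  assumes "i < j" "x ^ i = x ^ j" shows "CARD('p) ^ n - 1 \<le> j - i"
proof (rule ord)
  show "x ^ (j - i) = 1" using x0 assms by (rule power_diff_eq_one)
qed (use assms in simp)

text \<open>
  The conjugates \<open>x ^ (p ^ i)\<close> for \<open>i < n\<close> are distinct roots of \<open>f\<close>, hence all of them, and \<open>det C\<close> is
  their product.
\<close>
lemma norm_eq: "to_ac (det C) = x ^ (\<Sum>i<n. CARD('p) ^ i)"
proof -
  let ?F = "map_poly to_ac f"
  let ?r = "\<lambda>i. x ^ CARD('p) ^ i"
  have p2: "CARD('p) \<ge> 2" by (rule prime_ge_2_nat[OF prime_card])
  have lt: "?r i \<noteq> ?r j" if "i < j" "j < n" for i j
  proof
    assume "?r i = ?r j"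
    then have "CARD('p) ^ n - 1 \<le> CARD('p) ^ j - CARD('p) ^ i"
      by (rule x_pow_eq_gap[OF power_gap(1)[OF p2 that]])
    then show False using power_gap(2)[OF p2 that] by (rule leD[THEN notE])
  qed
  have inj: "inj_on ?r {..<n}"
    using lt by (rule inj_on_lessThanI)
  have root: "poly ?F (?r i) = 0" for i
    using min by (simp add: poly_map_to_ac_frobenius is_minimal_poly_def power_0_left)
  have degF: "Polynomial.degree ?F = n" using deg by (subst Polynomial.degree_map_poly) auto
  have "Polynomial.lead_coeff ?F = 1" using min deg degF by (simp add: coeff_map_poly is_minimal_poly_def)
  then have "?F = (\<Prod>y\<in>?r ` {..<n}. [:- y, 1:])"
    using root degF inj by (intro monic_eq_prod_roots) (auto simp: card_image)
  also have "\<dots> = (\<Prod>i<n. [:- ?r i, 1:])" using inj by (simp add: prod.reindex)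
  finally have "poly ?F 0 = poly (\<Prod>i<n. [:- ?r i, 1:]) 0" by simp
  then have "to_ac (Polynomial.coeff f 0) = (\<Prod>i<n. - ?r i)"
    unfolding poly_prod by (simp add: poly_0_coeff_0 coeff_map_poly)
  also have "\<dots> = (\<Prod>i<n. (- 1) * ?r i)" by simp
  also have "\<dots> = (- 1) ^ n * x ^ (\<Sum>i<n. CARD('p) ^ i)"
    unfolding prod.distrib by (simp add: power_sum)
  finally have *: "to_ac (Polynomial.coeff f 0) = (- 1) ^ n * x ^ (\<Sum>i<n. CARD('p) ^ i)" .
  have "(- 1) ^ n * (- 1) ^ n = (1 :: 'p mod_ring alg_closure)" by (simp flip: power_mult_distrib)
  then show ?thesis
    unfolding det_companion_mat[OF deg n] by (simp add: * flip: mult.assoc)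
qed

text \<open>
  \<open>det C ^ m = 1\<close> gives \<open>x ^ (N m) = 1\<close> for \<open>N = 1 + p + ... + p^(n-1)\<close>, and \<open>p^n - 1 = (p - 1) N\<close>.
\<close>
lemma det_order:
  assumes m: "m > 0" "det C ^ m = 1"
  shows "CARD('p) - 1 \<le> m"
proof -
  let ?N = "\<Sum>i<n. CARD('p) ^ i"
  have p2: "CARD('p) \<ge> 2" by (rule prime_ge_2_nat[OF prime_card])
  have N: "?N > 0" using n by (intro sum_pos) auto
  have "x ^ (?N * m) = to_ac (det C ^ m)" by (simp add: norm_eq power_mult)
  then have "x ^ (?N * m) = 1" using m by simp
  then have "CARD('p) ^ n - 1 \<le> ?N * m" using N m by (intro ord) auto
  moreover have "CARD('p) ^ n - 1 = (CARD('p) - 1) * ?N"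
    using p2 by (intro power_minus_one_nat) linarith
  ultimately have "(CARD('p) - 1) * ?N \<le> m * ?N" by (simp only: mult.commute)
  then show ?thesis using N by (simp only: mult_le_cancel2)
qed

lemma det_nonzero: "det C \<noteq> 0"
  using norm_eq x0 by (metis power_not_zero to_ac_0)

lemma det_generates:
  assumes "c \<noteq> 0"
  shows "\<exists>i. det C ^ i = c"
proof -
  have "inj_on (\<lambda>i. det C ^ i) {..<CARD('p) - 1}"
  proof (rule inj_on_lessThanI)
    fix i j assume ij: "i < j" "j < CARD('p) - 1"
    show "det C ^ i \<noteq> det C ^ j"
    proof
      assume eq: "det C ^ i = det C ^ j"
      have "det C ^ (j - i) = 1" using det_nonzero ij(1) eq by (rule power_diff_eq_one)
      then have "CARD('p) - 1 \<le> j - i" using ij by (intro det_order) auto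
      then show False using ij by linarith
    qed
  qed
  then have card: "card ((\<lambda>i. det C ^ i) ` {..<CARD('p) - 1}) = CARD('p) - 1" by (simp add: card_image)
  have "(\<lambda>i. det C ^ i) ` {..<CARD('p) - 1} = UNIV - {0}"
  proof (rule card_subset_eq)
    show "(\<lambda>i. det C ^ i) ` {..<CARD('p) - 1} \<subseteq> UNIV - {0}" using det_nonzero by auto
    show "card ((\<lambda>i. det C ^ i) ` {..<CARD('p) - 1}) = card (UNIV - {0 :: 'p mod_ring})"
      unfolding card by (simp add: card_Diff_singleton)
  qed simp
  then have "c \<in> (\<lambda>i. det C ^ i) ` {..<CARD('p) - 1}" using assms by simp
  then show ?thesis by (auto simp: eq_commute)
qed

text \<open>
  The coordinate isomorphism of \<open>F_p^n\<close> with the field generated by \<open>x\<close>; it turns \<open>C\<close> into multiplication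
  by \<open>x\<close>.
\<close>
definition \<theta> :: "'p mod_ring vec \<Rightarrow> 'p mod_ring alg_closure" where
  "\<theta> w = (\<Sum>i<n. to_ac (w $ i) * x ^ i)"

lemma \<theta>_minus:
  assumes "v \<in> carrier_vec n" "w \<in> carrier_vec n"
  shows "\<theta> (v - w) = \<theta> v - \<theta> w"
  using assms by (simp add: \<theta>_def algebra_simps sum_subtractf)

lemma \<theta>_zero: "\<theta> (0\<^sub>v n) = 0"
  unfolding \<theta>_def by (rule sum.neutral) simp

lemma \<theta>_nonzero:
  assumes w: "w \<in> carrier_vec n" "w \<noteq> 0\<^sub>v n"
  shows "\<theta> w \<noteq> 0"
proof
  assume z: "\<theta> w = 0"
  define g where "g = (\<Sum>i<n. Polynomial.monom (w $ i) i)"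
  have coeff: "Polynomial.coeff g j = (if j < n then w $ j else 0)" for j
    by (simp add: g_def coeff_sum)
  have "map_poly to_ac g = (\<Sum>i<n. Polynomial.monom (to_ac (w $ i)) i)"
    by (intro poly_eqI) (simp add: coeff_map_poly coeff coeff_sum)
  then have "poly (map_poly to_ac g) x = 0" using z by (simp add: \<theta>_def poly_sum poly_monom)
  moreover obtain i where "i < n" "w $ i \<noteq> 0" using w by (metis carrier_vecD eq_vecI index_zero_vec)
  then have "g \<noteq> 0" using coeff[of i] by auto
  ultimately have "n \<le> Polynomial.degree g" using min deg by (auto simp: is_minimal_poly_def)
  moreover have "Polynomial.degree g < n" using n coeff \<open>g \<noteq> 0\<close>
    by (metis leading_coeff_0_iff)
  ultimately show False by simp
qed

lemma \<theta>_C: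
  assumes w: "w \<in> carrier_vec n"
  shows "\<theta> (C *\<^sub>v w) = x * \<theta> w"
proof -
  have Cw: "(C *\<^sub>v w) $ i = (if i = 0 then 0 else w $ (i - 1)) - Polynomial.coeff f i * w $ (n - 1)"
    if i: "i < n" for i
  proof -
    have "(C *\<^sub>v w) $ i = (\<Sum>j<n. C $$ (i, j) * w $ j)"
      using w i C by (simp add: scalar_prod_def lessThan_atLeast0 del: C)
    also have "\<dots> = (\<Sum>j<n. (if j = n - 1 then - Polynomial.coeff f i * w $ (n - 1) else 0) +
        (if j = i - 1 then (if i = 0 then 0 else w $ (i - 1)) else 0))"
      using i deg by (intro sum.cong) (auto simp: companion_mat_def)
    also have "\<dots> = - Polynomial.coeff f i * w $ (n - 1) + (if i = 0 then 0 else w $ (i - 1))"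
      unfolding sum.distrib using i n by (simp add: less_imp_diff_less)
    finally show ?thesis by simp
  qed
  obtain k where k: "n = Suc k" using n by (cases n) auto
  have "poly (map_poly to_ac f) x = 0" using min by (simp add: is_minimal_poly_def)
  then have "(\<Sum>i\<le>n. to_ac (Polynomial.coeff f i) * x ^ i) = 0"
    using deg by (subst (asm) poly_altdef, subst (asm) Polynomial.degree_map_poly) (auto simp: coeff_map_poly)
  then have "(\<Sum>i<Suc n. to_ac (Polynomial.coeff f i) * x ^ i) = 0" by (simp add: lessThan_Suc_atMost)
  moreover have "Polynomial.coeff f n = 1" using min deg by (simp add: is_minimal_poly_def)
  ultimately have xn: "(\<Sum>i<n. to_ac (Polynomial.coeff f i) * x ^ i) = - (x ^ n)"
    by (simp add: eq_neg_iff_add_eq_0)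
  have "\<theta> (C *\<^sub>v w) = (\<Sum>i<n. to_ac (if i = 0 then 0 else w $ (i - 1)) * x ^ i) -
      to_ac (w $ (n - 1)) * (\<Sum>i<n. to_ac (Polynomial.coeff f i) * x ^ i)"
    unfolding \<theta>_def by (simp add: Cw sum_subtractf sum_distrib_left algebra_simps)
  also have "(\<Sum>i<n. to_ac (if i = 0 then 0 else w $ (i - 1)) * x ^ i) = (\<Sum>i<k. to_ac (w $ i) * x ^ Suc i)"
    unfolding k by (subst sum.lessThan_Suc_shift) simp
  also have "\<dots> - to_ac (w $ (n - 1)) * (\<Sum>i<n. to_ac (Polynomial.coeff f i) * x ^ i) = x * \<theta> w"
    unfolding xn \<theta>_def by (simp add: k sum_distrib_left algebra_simps)
  finally show ?thesis .
qed

lemma \<theta>_C_pow: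
  assumes w: "w \<in> carrier_vec n"
  shows "\<theta> (C ^\<^sub>m i *\<^sub>v w) = x ^ i * \<theta> w"
  using w
proof (induction i arbitrary: w)
  case 0
  have "C ^\<^sub>m 0 = 1\<^sub>m n" using carrier_matD(1)[OF C] by simp
  then show ?case using 0 by simp
next
  case (Suc i)
  have "C ^\<^sub>m Suc i *\<^sub>v w = C ^\<^sub>m i *\<^sub>v (C *\<^sub>v w)"
    using Suc.prems by (simp add: assoc_mult_mat_vec[of _ n n _ n])
  then show ?case using Suc \<theta>_C by (simp add: mult_mat_vec_carrier[of _ n n])
qed

lemma C_pow_vec [simp]: "w \<in> carrier_vec n \<Longrightarrow> C ^\<^sub>m i *\<^sub>v w \<in> carrier_vec n"
  by (rule mult_mat_vec_carrier[OF C_pow])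

lemma x_pow_inj:
  assumes "i < j" "j < CARD('p) ^ n - 1" shows "x ^ i \<noteq> x ^ j"
proof
  assume eq: "x ^ i = x ^ j"
  then show False using x_pow_eq_gap[OF assms(1)] assms by linarith
qed

lemma card_nonzero_vecs: "card (carrier_vec n - {0\<^sub>v n :: 'p mod_ring vec}) = CARD('p) ^ n - 1"
  by (simp add: card_carrier_vec card_Diff_singleton card_carrier_vec(2))

lemma covers_nonzero_vecs:
  assumes "inj_on g {..<CARD('p) ^ n - 1}" "\<And>i. g i \<in> carrier_vec n" "\<And>i. g i \<noteq> 0\<^sub>v n"
    and w: "w \<in> carrier_vec n" "w \<noteq> (0\<^sub>v n :: 'p mod_ring vec)"
  shows "\<exists>i. g i = w"
proof -
  let ?N = "carrier_vec n - {0\<^sub>v n :: 'p mod_ring vec}"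
  have "g ` {..<CARD('p) ^ n - 1} = ?N"
  proof (rule card_subset_eq)
    show "finite ?N"
      using card_carrier_vec(2) by (rule finite_Diff)
    show "card (g ` {..<CARD('p) ^ n - 1}) = card ?N"
      unfolding card_image[OF assms(1)] card_nonzero_vecs by simp
    show "g ` {..<CARD('p) ^ n - 1} \<subseteq> ?N" using assms(2,3) by (intro image_subsetI) auto
  qed
  moreover have "w \<in> ?N" using w by simp
  ultimately have "w \<in> g ` {..<CARD('p) ^ n - 1}" by (simp only:)
  then obtain i where "w = g i" by (rule imageE)
  then show ?thesis by metis
qed

lemma transitive_vec:
  assumes v: "v \<in> carrier_vec n" "v \<noteq> 0\<^sub>v n" and w: "w \<in> carrier_vec n" "w \<noteq> 0\<^sub>v n"
  shows "\<exists>i. C ^\<^sub>m i *\<^sub>v v = w"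
proof (rule covers_nonzero_vecs[OF _ _ _ w])
  show "inj_on (\<lambda>i. C ^\<^sub>m i *\<^sub>v v) {..<CARD('p) ^ n - 1}"
  proof (rule inj_on_lessThanI)
    fix i j assume "i < j" "j < CARD('p) ^ n - 1"
    then have "\<theta> (C ^\<^sub>m i *\<^sub>v v) \<noteq> \<theta> (C ^\<^sub>m j *\<^sub>v v)"
      using x_pow_inj \<theta>_nonzero[OF v] by (simp add: \<theta>_C_pow[OF v(1)])
    then show "C ^\<^sub>m i *\<^sub>v v \<noteq> C ^\<^sub>m j *\<^sub>v v" by metis
  qed
  show "C ^\<^sub>m i *\<^sub>v v \<in> carrier_vec n" for i using v(1) by (rule C_pow_vec)
  show "C ^\<^sub>m i *\<^sub>v v \<noteq> 0\<^sub>v n" for i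
  proof
    assume z: "C ^\<^sub>m i *\<^sub>v v = 0\<^sub>v n"
    have "x ^ i * \<theta> v = \<theta> (C ^\<^sub>m i *\<^sub>v v)" by (rule \<theta>_C_pow[OF v(1), symmetric])
    also have "\<dots> = 0" unfolding z by (rule \<theta>_zero)
    finally show False using \<theta>_nonzero[OF v] x0 by simp
  qed
qed

lemma \<theta>_inj:
  assumes "y \<in> carrier_vec n" "z \<in> carrier_vec n" "\<theta> y = \<theta> z"
  shows "y = z"
proof -
  have "y - z = 0\<^sub>v n" using \<theta>_nonzero[of "y - z"] assms by (auto simp: \<theta>_minus)
  then have "(y - z) $ k = 0" if "k < n" for k using that by simp
  then show ?thesis using assms(1,2) by (intro eq_vecI) auto
qed

text \<open>
  Such an \<open>h\<close> is injective, hence surjective on the finite space. This transfers transitivity from vectors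
  to linear forms.
\<close>
lemma covec_eq_zero:
  assumes \<phi>: "\<phi> \<in> carrier_vec n" and c: "c \<noteq> 0"
    and h: "\<And>y. y \<in> carrier_vec n \<Longrightarrow> h y \<in> carrier_vec n"
      "\<And>y. y \<in> carrier_vec n \<Longrightarrow> \<theta> (h y) = c * \<theta> y"
    and zero: "\<And>y. y \<in> carrier_vec n \<Longrightarrow> \<phi> \<bullet> h y = 0"
  shows "\<phi> = 0\<^sub>v n"
proof -
  have "inj_on h (carrier_vec n)"
  proof (rule inj_onI)
    fix y z assume yz: "y \<in> carrier_vec n" "z \<in> carrier_vec n" "h y = h z"
    then have "c * \<theta> y = c * \<theta> z" using h(2) by metis
    then show "y = z" using \<theta>_inj[OF yz(1,2)] c by simp
  qed
  then have "h ` carrier_vec n = carrier_vec n"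
    using h(1) by (intro endo_inj_surj card_carrier_vec(2)) auto
  then have "\<phi> \<bullet> unit_vec n i = 0" if "i < n" for i
    using zero by (metis imageE unit_vec_carrier)
  then show ?thesis using \<phi> by (intro eq_vecI) auto
qed

lemma transitive_covec:
  assumes \<phi>: "\<phi> \<in> carrier_vec n" "\<phi> \<noteq> 0\<^sub>v n" and \<psi>: "\<psi> \<in> carrier_vec n" "\<psi> \<noteq> 0\<^sub>v n"
  shows "\<exists>i. (C ^\<^sub>m i)\<^sup>T *\<^sub>v \<phi> = \<psi>"
proof -
  define g where "g i = (C ^\<^sub>m i)\<^sup>T *\<^sub>v \<phi>" for i
  have gc: "g i \<in> carrier_vec n" for i
    using \<phi> unfolding g_def by (auto intro!: mult_mat_vec_carrier[of _ n n])
  have g: "g i \<bullet> y = \<phi> \<bullet> (C ^\<^sub>m i *\<^sub>v y)" if "y \<in> carrier_vec n" for i y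
    using that \<phi> unfolding g_def by (intro transpose_vec_mult_scalar[of _ n n]) auto
  have "inj_on g {..<CARD('p) ^ n - 1}"
  proof (rule inj_on_lessThanI)
    fix i j assume ij: "i < j" "j < CARD('p) ^ n - 1"
    show "g i \<noteq> g j"
    proof
      assume eq: "g i = g j"
      have "\<phi> = 0\<^sub>v n"
      proof (rule covec_eq_zero[where c = "x ^ i - x ^ j" and h = "\<lambda>y. C ^\<^sub>m i *\<^sub>v y - C ^\<^sub>m j *\<^sub>v y"])
        fix y :: "'p mod_ring vec" assume y: "y \<in> carrier_vec n"
        show "\<theta> (C ^\<^sub>m i *\<^sub>v y - C ^\<^sub>m j *\<^sub>v y) = (x ^ i - x ^ j) * \<theta> y"
          using y by (simp add: \<theta>_minus \<theta>_C_pow left_diff_distrib)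
        have "\<phi> \<bullet> (C ^\<^sub>m i *\<^sub>v y - C ^\<^sub>m j *\<^sub>v y) = g i \<bullet> y - g j \<bullet> y"
          using \<phi>(1) y unfolding g[OF y] by (intro scalar_prod_minus_distrib[of _ n]) auto
        then show "\<phi> \<bullet> (C ^\<^sub>m i *\<^sub>v y - C ^\<^sub>m j *\<^sub>v y) = 0" unfolding eq by simp
      qed (use x_pow_inj[OF ij] \<phi>(1) in auto)
      then show False using \<phi>(2) by contradiction
    qed
  qed
  moreover have "g i \<noteq> 0\<^sub>v n" for i
  proof
    assume z: "g i = 0\<^sub>v n"
    have "\<phi> = 0\<^sub>v n"
      by (rule covec_eq_zero[where c = "x ^ i" and h = "\<lambda>y. C ^\<^sub>m i *\<^sub>v y"])
        (use \<phi>(1) x0 \<theta>_C_pow z g[of _ i] in auto)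
    then show False using \<phi>(2) by contradiction
  qed
  ultimately show ?thesis using covers_nonzero_vecs[of g \<psi>] gc \<psi> unfolding g_def by metis
qed

lemma det_pow: "det (C ^\<^sub>m i) = det C ^ i"
proof (induction i)
  case 0
  have "C ^\<^sub>m 0 = 1\<^sub>m n" using carrier_matD(1)[OF C] by simp
  then show ?case by simp
qed (simp add: det_mult[OF C_pow C])

end

section \<open>Subgroups containing a Singer cycle and normalised by a homology\<close>

lemma (in group) cancel_left: "a \<in> carrier G \<Longrightarrow> b \<in> carrier G \<Longrightarrow> a \<otimes> (inv a \<otimes> b) = b"
  by (simp add: m_assoc[symmetric])

lemma (in group) inv_cancel_left: "a \<in> carrier G \<Longrightarrow> b \<in> carrier G \<Longrightarrow> inv a \<otimes> (a \<otimes> b) = b"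
  by (simp add: m_assoc[symmetric])

lemma (in group) conj_generate:
  assumes S: "S \<subseteq> carrier G" and g: "g \<in> carrier G"
    and conj: "\<And>s. s \<in> S \<Longrightarrow> g \<otimes> s \<otimes> inv g \<in> generate G S"
    and h: "h \<in> generate G S"
  shows "g \<otimes> h \<otimes> inv g \<in> generate G S"
  using h
proof (induction rule: generate.induct)
  case one
  then show ?case using g by (simp add: generate.one)
next
  case (incl s)
  then show ?case by (rule conj)
next
  case (inv s)
  then have "s \<in> carrier G" using S by blast
  then have "g \<otimes> inv s \<otimes> inv g = inv (g \<otimes> s \<otimes> inv g)"
    using g by (simp add: inv_mult_group m_assoc)
  then show ?case using generate_m_inv_closed[OF S conj[OF inv]] by simp
next
  case (eng a b)
  then have ab: "a \<in> carrier G" "b \<in> carrier G" using generate_in_carrier[OF S] by auto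
  have "g \<otimes> (a \<otimes> b) \<otimes> inv g = (g \<otimes> a \<otimes> inv g) \<otimes> (g \<otimes> b \<otimes> inv g)"
    using g ab by (simp add: m_assoc inv_cancel_left)
  then show ?case using generate.eng[OF eng.IH] by simp
qed

text \<open>
  The coset \<open>D H\<close> behaves like a conjugation-closed subset: quotients of its elements lie in \<open>H\<close>, and it is
  stable under conjugation by \<open>H\<close> and by itself.
\<close>
locale normalized_subgroup = group +
  fixes H and D
  assumes H: "subgroup H G" and D: "D \<in> carrier G"
    and normal: "\<And>h. h \<in> H \<Longrightarrow> inv D \<otimes> h \<otimes> D \<in> H"
begin

definition "coset = (\<lambda>h. D \<otimes> h) ` H"

lemma H_carrier: "h \<in> H \<Longrightarrow> h \<in> carrier G"
  using subgroup.subset[OF H] by blast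

lemma coset_carrier: "r \<in> coset \<Longrightarrow> r \<in> carrier G"
  using H_carrier D by (auto simp: coset_def)

lemma D_in_coset: "D \<in> coset"
  unfolding coset_def by (rule image_eqI[of _ _ \<one>]) (use D subgroup.one_closed[OF H] in auto)

lemma cosetI: "D \<otimes> h = r \<Longrightarrow> h \<in> H \<Longrightarrow> r \<in> coset"
  by (auto simp: coset_def)

lemma coset_inv_mult:
  assumes "r \<in> coset" "s \<in> coset"
  shows "inv r \<otimes> s \<in> H"
proof -
  obtain h k where hk: "h \<in> H" "k \<in> H" "r = D \<otimes> h" "s = D \<otimes> k" using assms by (auto simp: coset_def)
  have "inv r \<otimes> s = inv h \<otimes> k"
    using hk D H_carrier by (simp add: inv_mult_group m_assoc inv_cancel_left)
  then show ?thesis using hk H by (simp add: subgroup.m_closed subgroup.m_inv_closed)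
qed

lemma coset_conj_H:
  assumes "r \<in> coset" "h \<in> H"
  shows "inv r \<otimes> h \<otimes> r \<in> H"
proof -
  obtain k where k: "k \<in> H" "r = D \<otimes> k" using assms by (auto simp: coset_def)
  have "inv r \<otimes> h \<otimes> r = inv k \<otimes> (inv D \<otimes> h \<otimes> D) \<otimes> k"
    using k D H_carrier assms(2) by (simp add: inv_mult_group m_assoc)
  then show ?thesis using k H normal[OF assms(2)] by (simp add: subgroup.m_closed subgroup.m_inv_closed)
qed

lemma H_mult_coset:
  assumes "h \<in> H" "r \<in> coset"
  shows "h \<otimes> r \<in> coset"
proof -
  obtain k where k: "k \<in> H" "r = D \<otimes> k" using assms by (auto simp: coset_def)
  have "D \<otimes> ((inv D \<otimes> h \<otimes> D) \<otimes> k) = h \<otimes> r"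
    using k D H_carrier assms(1) by (simp add: m_assoc cancel_left)
  then show ?thesis by (rule cosetI) (use k H normal[OF assms(1)] in \<open>simp add: subgroup.m_closed\<close>)
qed

lemma coset_mult_H:
  assumes "h \<in> H" "r \<in> coset"
  shows "r \<otimes> h \<in> coset"
proof -
  obtain k where k: "k \<in> H" "r = D \<otimes> k" using assms by (auto simp: coset_def)
  have "D \<otimes> (k \<otimes> h) = r \<otimes> h" using k D H_carrier assms(1) by (simp add: m_assoc)
  then show ?thesis by (rule cosetI) (use k H assms(1) in \<open>simp add: subgroup.m_closed\<close>)
qed

lemma coset_conj_coset:
  assumes "r \<in> coset" "s \<in> coset"
  shows "inv r \<otimes> s \<otimes> r \<in> coset"
  using H_mult_coset[OF coset_inv_mult[OF assms] assms(1)] .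

lemma H_conj_coset:
  assumes "h \<in> H" "r \<in> coset"
  shows "h \<otimes> r \<otimes> inv h \<in> coset"
  by (intro coset_mult_H H_mult_coset assms subgroup.m_inv_closed[OF H])

end

lemma rank_one_transpose: "(rank_one n u \<phi>)\<^sup>T = rank_one n \<phi> u"
  by (intro eq_matI) (auto simp: rank_one_def mult.commute)

lemma rank_one_inverse:
  fixes \<phi> :: "'a::field vec"
  assumes "u \<in> carrier_vec n" "\<phi> \<in> carrier_vec n" "\<phi> \<bullet> u = d - 1" "d \<noteq> 0"
  shows "rank_one n u ((- 1 / d) \<cdot>\<^sub>v \<phi>) * rank_one n u \<phi> = 1\<^sub>m n"
proof -
  have "(- 1 / d) \<cdot>\<^sub>v \<phi> + \<phi> + (((- 1 / d) \<cdot>\<^sub>v \<phi>) \<bullet> u) \<cdot>\<^sub>v \<phi> = 0\<^sub>v n"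
    using assms by (intro eq_vecI) (auto simp: field_simps)
  then show ?thesis using assms by (simp add: rank_one_mult_same_center rank_one_zero)
qed

lemma pairing_conj:
  fixes g h :: "'a::comm_ring_1 mat"
  assumes "g \<in> carrier_mat n n" "h \<in> carrier_mat n n" "h * g = 1\<^sub>m n"
    "v \<in> carrier_vec n" "\<phi> \<in> carrier_vec n"
  shows "(h\<^sup>T *\<^sub>v \<phi>) \<bullet> (g *\<^sub>v v) = \<phi> \<bullet> v"
proof -
  have "(h\<^sup>T *\<^sub>v \<phi>) \<bullet> (g *\<^sub>v v) = \<phi> \<bullet> (h *\<^sub>v (g *\<^sub>v v))"
    using assms by (intro transpose_vec_mult_scalar[of _ n n]) auto
  also have "h *\<^sub>v (g *\<^sub>v v) = v" using assms by (metis assoc_mult_mat_vec one_mult_mat_vec)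
  finally show ?thesis .
qed

text \<open>
  The geometric situation of the theorem: \<open>H\<close> contains a Singer cycle and is normalised by a homology
  of ratio \<open>d\<close>.
\<close>
locale singer_homology = singer_cycle f n x + normalized_subgroup "GL TYPE('p mod_ring) n" H "rank_one n w \<eta>"
  for f :: "'p::prime_card mod_ring poly" and n x and H :: "'p mod_ring mat set" and w \<eta> +
  fixes d :: "'p mod_ring"
  assumes n3: "n \<ge> 3" and char2: "(2 :: 'p mod_ring) \<noteq> 0" and d: "d \<noteq> 0" "d * d \<noteq> 1"
    and w: "w \<in> carrier_vec n" "\<eta> \<in> carrier_vec n" "\<eta> \<bullet> w = d - 1"
    and C_in_H: "C \<in> H"
begin

abbreviation "GLn \<equiv> GL TYPE('p mod_ring) n"

definition R :: "'p mod_ring vec \<Rightarrow> 'p mod_ring vec \<Rightarrow> bool" where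
  "R u \<phi> \<longleftrightarrow> u \<in> carrier_vec n \<and> \<phi> \<in> carrier_vec n \<and> \<phi> \<bullet> u = d - 1 \<and> rank_one n u \<phi> \<in> coset"

definition T :: "'p mod_ring vec \<Rightarrow> 'p mod_ring vec \<Rightarrow> bool" where
  "T v \<phi> \<longleftrightarrow> v \<in> carrier_vec n \<and> \<phi> \<in> carrier_vec n \<and> \<phi> \<bullet> v = 0 \<and> rank_one n v \<phi> \<in> H"

lemma H_mat: "h \<in> H \<Longrightarrow> h \<in> carrier_mat n n"
  using H_carrier by (simp add: GL_simps)

lemma H_mult: "g \<in> H \<Longrightarrow> h \<in> H \<Longrightarrow> g * h \<in> H"
  using subgroup.m_closed[OF H] by (simp add: GL_simps)

lemma C_pow_H: "C ^\<^sub>m i \<in> H"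
proof (induction i)
  case 0
  have "C ^\<^sub>m 0 = 1\<^sub>m n" using carrier_matD(1)[OF C] by simp
  then show ?case using subgroup.one_closed[OF H] by (simp add: GL_simps)
qed (simp add: H_mult C_in_H)

lemma inv_mat:
  assumes "g \<in> carrier GLn"
  shows "inv\<^bsub>GLn\<^esub> g \<in> carrier_mat n n" "inv\<^bsub>GLn\<^esub> g * g = 1\<^sub>m n" "g * inv\<^bsub>GLn\<^esub> g = 1\<^sub>m n"
  using inv_closed[OF assms] l_inv[OF assms] r_inv[OF assms] by (simp_all add: GL_simps)

lemma inv_homology:
  assumes "R u \<phi>"
  shows "inv\<^bsub>GLn\<^esub> (rank_one n u \<phi>) = rank_one n u ((- 1 / d) \<cdot>\<^sub>v \<phi>)"
proof (rule inv_equality)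
  note r = assms[unfolded R_def]
  show "rank_one n u ((- 1 / d) \<cdot>\<^sub>v \<phi>) \<otimes>\<^bsub>GLn\<^esub> rank_one n u \<phi> = \<one>\<^bsub>GLn\<^esub>"
    using rank_one_inverse[of u n \<phi> d] r d by (simp add: GL_simps)
  show "rank_one n u \<phi> \<in> carrier GLn" using r coset_carrier by blast
  have "det (rank_one n u ((- 1 / d) \<cdot>\<^sub>v \<phi>)) * det (rank_one n u \<phi>) = 1"
    using rank_one_inverse[of u n \<phi> d] r d by (simp flip: det_mult[of _ n])
  then show "rank_one n u ((- 1 / d) \<cdot>\<^sub>v \<phi>) \<in> carrier GLn" by (auto simp: GL_simps)
qed

lemma conj_rank_one:
  assumes "g \<in> carrier GLn" "v \<in> carrier_vec n" "\<phi> \<in> carrier_vec n"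
  shows "g \<otimes>\<^bsub>GLn\<^esub> rank_one n v \<phi> \<otimes>\<^bsub>GLn\<^esub> inv\<^bsub>GLn\<^esub> g = rank_one n (g *\<^sub>v v) ((inv\<^bsub>GLn\<^esub> g)\<^sup>T *\<^sub>v \<phi>)"
    "((inv\<^bsub>GLn\<^esub> g)\<^sup>T *\<^sub>v \<phi>) \<bullet> (g *\<^sub>v v) = \<phi> \<bullet> v"
    "g *\<^sub>v v \<in> carrier_vec n" "(inv\<^bsub>GLn\<^esub> g)\<^sup>T *\<^sub>v \<phi> \<in> carrier_vec n"
proof -
  have g: "g \<in> carrier_mat n n" using assms by (simp add: GL_simps)
  note i = inv_mat[OF assms(1)]
  show "g \<otimes>\<^bsub>GLn\<^esub> rank_one n v \<phi> \<otimes>\<^bsub>GLn\<^esub> inv\<^bsub>GLn\<^esub> g = rank_one n (g *\<^sub>v v) ((inv\<^bsub>GLn\<^esub> g)\<^sup>T *\<^sub>v \<phi>)"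
    unfolding GL_simps by (rule rank_one_conj[OF assms(2,3) g i(1,3)])
  show "((inv\<^bsub>GLn\<^esub> g)\<^sup>T *\<^sub>v \<phi>) \<bullet> (g *\<^sub>v v) = \<phi> \<bullet> v"
    by (rule pairing_conj[OF g i(1,2) assms(2,3)])
  show "g *\<^sub>v v \<in> carrier_vec n" using g assms(2) by simp
  show "(inv\<^bsub>GLn\<^esub> g)\<^sup>T *\<^sub>v \<phi> \<in> carrier_vec n"
    using i(1) assms(3) by (intro mult_mat_vec_carrier[of _ n n]) auto
qed

lemma R_conj_H: "g \<in> H \<Longrightarrow> R u \<phi> \<Longrightarrow> R (g *\<^sub>v u) ((inv\<^bsub>GLn\<^esub> g)\<^sup>T *\<^sub>v \<phi>)"
  using conj_rank_one[of g u \<phi>] H_conj_coset[of g "rank_one n u \<phi>"] H_carrier[of g] by (simp add: R_def)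

lemma T_conj_H:
  assumes "g \<in> H" "T u \<phi>"
  shows "T (g *\<^sub>v u) ((inv\<^bsub>GLn\<^esub> g)\<^sup>T *\<^sub>v \<phi>)"
proof -
  have "g \<otimes>\<^bsub>GLn\<^esub> rank_one n u \<phi> \<otimes>\<^bsub>GLn\<^esub> inv\<^bsub>GLn\<^esub> g \<in> H"
    using assms H by (intro subgroup.m_closed[OF H] subgroup.m_inv_closed[OF H]) (auto simp: T_def)
  then show ?thesis using conj_rank_one[of g u \<phi>] H_carrier[of g] assms by (simp add: T_def)
qed

lemma base: "R w \<eta>"
  using w D_in_coset by (simp add: R_def)

lemma w_nonzero: "w \<noteq> 0\<^sub>v n" "\<eta> \<noteq> 0\<^sub>v n"
  using w d by auto

lemma T_add_axis:
  assumes "T v \<phi>" "T v \<psi>" shows "T v (\<phi> + \<psi>)"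
proof -
  note t = assms[unfolded T_def]
  have "rank_one n v \<phi> * rank_one n v \<psi> = rank_one n v (\<phi> + \<psi> + 0 \<cdot>\<^sub>v \<psi>)"
    using t rank_one_mult_same_center[of v n \<phi> \<psi>] by simp
  also have "\<phi> + \<psi> + 0 \<cdot>\<^sub>v \<psi> = \<phi> + \<psi>" using t by auto
  finally show ?thesis using t H_mult[of "rank_one n v \<phi>" "rank_one n v \<psi>"]
    by (simp add: T_def add_scalar_prod_distrib[of _ n])
qed

lemma T_add_center:
  assumes "T u \<phi>" "T v \<phi>" shows "T (u + v) \<phi>"
proof -
  note t = assms[unfolded T_def]
  have "rank_one n u \<phi> * rank_one n v \<phi> = rank_one n (u + v) \<phi>"
    using t by (intro rank_one_mult_same_axis) auto
  then show ?thesis using t H_mult[of "rank_one n u \<phi>" "rank_one n v \<phi>"]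
    by (simp add: T_def scalar_prod_add_distrib[of _ n])
qed

lemma T_zero: "v \<in> carrier_vec n \<Longrightarrow> T v (0\<^sub>v n)"
  using subgroup.one_closed[OF H] by (simp add: T_def rank_one_zero GL_simps)

text \<open>
  Over a prime field, scaling is repeated addition.
\<close>
lemma T_smult_axis:
  assumes "T v \<phi>" shows "T v (c \<cdot>\<^sub>v \<phi>)"
proof -
  have c: "v \<in> carrier_vec n" "\<phi> \<in> carrier_vec n" using assms by (auto simp: T_def)
  have "T v (of_nat m \<cdot>\<^sub>v \<phi>)" for m
  proof (induction m)
    case 0
    have "of_nat 0 \<cdot>\<^sub>v \<phi> = 0\<^sub>v n" using c by auto
    then show ?case using T_zero c by simp
  next
    case (Suc m)
    have "of_nat (Suc m) \<cdot>\<^sub>v \<phi> = \<phi> + of_nat m \<cdot>\<^sub>v \<phi>" using c by (intro eq_vecI) (auto simp: algebra_simps)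
    then show ?case using T_add_axis[OF assms Suc.IH] by simp
  qed
  then show ?thesis using surj_of_nat_mod_ring[of c] by metis
qed

lemma T_smult_center:
  assumes "T v \<phi>" shows "T (c \<cdot>\<^sub>v v) \<phi>"
  using T_smult_axis[OF assms, of c] assms rank_one_smult[of v n \<phi> c] by (auto simp: T_def)

lemma R_diff:
  assumes "R u \<phi>" "R u \<psi>" shows "T u (\<psi> - \<phi>)"
proof -
  note r = assms[unfolded R_def]
  have "inv\<^bsub>GLn\<^esub> (rank_one n u \<phi>) \<otimes>\<^bsub>GLn\<^esub> rank_one n u \<psi> \<in> H"
    using r by (intro coset_inv_mult) auto
  also have "inv\<^bsub>GLn\<^esub> (rank_one n u \<phi>) \<otimes>\<^bsub>GLn\<^esub> rank_one n u \<psi> =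
      rank_one n u ((- 1 / d) \<cdot>\<^sub>v \<phi> + \<psi> + (((- 1 / d) \<cdot>\<^sub>v \<phi>) \<bullet> u) \<cdot>\<^sub>v \<psi>)"
    unfolding inv_homology[OF assms(1)] GL_simps using r by (intro rank_one_mult_same_center) auto
  also have "(- 1 / d) \<cdot>\<^sub>v \<phi> + \<psi> + (((- 1 / d) \<cdot>\<^sub>v \<phi>) \<bullet> u) \<cdot>\<^sub>v \<psi> = (1 / d) \<cdot>\<^sub>v (\<psi> - \<phi>)"
  proof -
    have c: "u \<in> carrier_vec n" "\<phi> \<in> carrier_vec n" "\<psi> \<in> carrier_vec n" and \<phi>u: "\<phi> \<bullet> u = d - 1"
      using r by auto
    have e: "((- 1 / d) \<cdot>\<^sub>v \<phi>) \<bullet> u = - ((d - 1) / d)"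
      using smult_scalar_prod_distrib[OF c(2,1), of "- 1 / d"] unfolding \<phi>u by simp
    show ?thesis unfolding e using c d(1) by (intro eq_vecI) (auto simp: field_simps)
  qed
  finally have "T u ((1 / d) \<cdot>\<^sub>v (\<psi> - \<phi>))" using r
    by (auto simp: T_def minus_scalar_prod_distrib[of _ n])
  from T_smult_axis[OF this, of d] show ?thesis using d by (simp add: smult_smult_assoc)
qed

lemma R_add:
  assumes "R u \<phi>" "T u \<psi>" shows "R u (\<phi> + \<psi>)"
proof -
  note r = assms[unfolded R_def T_def]
  have "rank_one n u \<psi> * rank_one n u \<phi> = rank_one n u (\<psi> + \<phi> + 0 \<cdot>\<^sub>v \<phi>)"
    using r rank_one_mult_same_center[of u n \<psi> \<phi>] by simp
  also have "\<psi> + \<phi> + 0 \<cdot>\<^sub>v \<phi> = \<phi> + \<psi>" using r by (intro eq_vecI) auto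
  finally show ?thesis using r H_mult_coset[of "rank_one n u \<psi>" "rank_one n u \<phi>"]
    by (simp add: R_def GL_simps add_scalar_prod_distrib[of _ n])
qed

lemma conj_by_homology:
  assumes R: "R u \<phi>" and c: "v \<in> carrier_vec n" "\<psi> \<in> carrier_vec n"
  defines "r \<equiv> rank_one n u \<phi>"
  defines "v' \<equiv> v - (\<phi> \<bullet> v / d) \<cdot>\<^sub>v u" and "\<psi>' \<equiv> \<psi> + (\<psi> \<bullet> u) \<cdot>\<^sub>v \<phi>"
  shows "inv\<^bsub>GLn\<^esub> r \<otimes>\<^bsub>GLn\<^esub> rank_one n v \<psi> \<otimes>\<^bsub>GLn\<^esub> r = rank_one n v' \<psi>'" "\<psi>' \<bullet> v' = \<psi> \<bullet> v"
    "v' \<in> carrier_vec n" "\<psi>' \<in> carrier_vec n"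
proof -
  note rr = R[unfolded R_def]
  have r: "r \<in> carrier GLn" unfolding r_def using rr coset_carrier by blast
  have "inv\<^bsub>GLn\<^esub> r *\<^sub>v v = v + (((- 1 / d) \<cdot>\<^sub>v \<phi>) \<bullet> v) \<cdot>\<^sub>v u"
    unfolding r_def inv_homology[OF R] using rr c by (intro rank_one_mult_vec) auto
  also have "\<dots> = v'" using rr c unfolding v'_def by (intro eq_vecI) auto
  finally have 1: "inv\<^bsub>GLn\<^esub> r *\<^sub>v v = v'" .
  have 2: "r\<^sup>T *\<^sub>v \<psi> = \<psi>'"
    using rr c unfolding r_def \<psi>'_def rank_one_transpose
    by (simp add: rank_one_mult_vec comm_scalar_prod[of u n])
  have inv: "inv\<^bsub>GLn\<^esub> (inv\<^bsub>GLn\<^esub> r) = r" using r by simp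
  note conj_rank_one[OF inv_closed[OF r] c, unfolded inv 1 2]
  then show "inv\<^bsub>GLn\<^esub> r \<otimes>\<^bsub>GLn\<^esub> rank_one n v \<psi> \<otimes>\<^bsub>GLn\<^esub> r = rank_one n v' \<psi>'" "\<psi>' \<bullet> v' = \<psi> \<bullet> v"
    "v' \<in> carrier_vec n" "\<psi>' \<in> carrier_vec n" by blast+
qed

text \<open>
  A power of \<open>C\<close> that maps \<open>u\<close> to \<open>v\<close> maps transvections with centre \<open>u\<close> injectively to those with centre \<open>v\<close>.
\<close>
lemma card_T_le:
  assumes u: "u \<in> carrier_vec n" "u \<noteq> 0\<^sub>v n" and v: "v \<in> carrier_vec n" "v \<noteq> 0\<^sub>v n"
  shows "card {\<phi>. T u \<phi>} \<le> card {\<phi>. T v \<phi>}"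
proof -
  obtain i where i: "C ^\<^sub>m i *\<^sub>v u = v" using transitive_vec[OF u v] by blast
  define g where "g = C ^\<^sub>m i"
  have g: "g \<in> H" "g \<in> carrier GLn" "g \<in> carrier_mat n n"
    using C_pow_H H_carrier by (auto simp: g_def)
  let ?h = "(inv\<^bsub>GLn\<^esub> g)\<^sup>T"
  have hc: "?h \<in> carrier_mat n n" using inv_mat(1)[OF g(2)] by simp
  have undo: "g\<^sup>T *\<^sub>v (?h *\<^sub>v \<phi>) = \<phi>" if "\<phi> \<in> carrier_vec n" for \<phi>
  proof -
    have "g\<^sup>T * ?h = (inv\<^bsub>GLn\<^esub> g * g)\<^sup>T"
      using g inv_mat(1)[OF g(2)] by (intro transpose_mult[symmetric]) auto
    also have "\<dots> = 1\<^sub>m n" unfolding inv_mat(2)[OF g(2)] by simp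
    finally have "g\<^sup>T * ?h *\<^sub>v \<phi> = \<phi>" using that by simp
    moreover have "g\<^sup>T * ?h *\<^sub>v \<phi> = g\<^sup>T *\<^sub>v (?h *\<^sub>v \<phi>)"
      using g hc that by (intro assoc_mult_mat_vec[of _ n n _ n]) auto
    ultimately show ?thesis by simp
  qed
  have fin: "finite {\<phi>. T v \<phi>}"
    by (rule finite_subset[OF _ card_carrier_vec(2)]) (auto simp: T_def)
  have "inj_on (\<lambda>\<phi>. ?h *\<^sub>v \<phi>) {\<phi>. T u \<phi>}"
    by (rule inj_on_inverseI[of _ "\<lambda>\<phi>. g\<^sup>T *\<^sub>v \<phi>"]) (auto simp: T_def undo)
  moreover have "(\<lambda>\<phi>. ?h *\<^sub>v \<phi>) ` {\<phi>. T u \<phi>} \<subseteq> {\<phi>. T v \<phi>}"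
    using T_conj_H[OF g(1), of u] i by (auto simp: g_def)
  ultimately show ?thesis using fin by (rule card_inj_on_le)
qed

sublocale homology_geometry n d R T
proof
  show "3 \<le> n" "(2 :: 'p mod_ring) \<noteq> 0" "d \<noteq> 0" "d * d \<noteq> 1" by (fact n3 char2 d)+
  show "T v (\<phi> + \<psi>)" if "T v \<phi>" "T v \<psi>" for v \<phi> \<psi> using that by (rule T_add_axis)
  show "T (u + v) \<phi>" if "T u \<phi>" "T v \<phi>" for u v \<phi> using that by (rule T_add_center)
  show "T v (c \<cdot>\<^sub>v \<phi>)" if "T v \<phi>" for v \<phi> c using that by (rule T_smult_axis)
  show "T (c \<cdot>\<^sub>v v) \<phi>" if "T v \<phi>" for v \<phi> c using that by (rule T_smult_center)
  show "T u (\<psi> - \<phi>)" if "R u \<phi>" "R u \<psi>" for u \<phi> \<psi> using that by (rule R_diff)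
  show "R u (\<phi> + \<psi>)" if "R u \<phi>" "T u \<psi>" for u \<phi> \<psi> using that by (rule R_add)
  show "u \<in> carrier_vec n \<and> \<phi> \<in> carrier_vec n \<and> \<phi> \<bullet> u = d - 1" if "R u \<phi>" for u \<phi>
    using that by (simp add: R_def)
  show "v \<in> carrier_vec n \<and> \<phi> \<in> carrier_vec n \<and> \<phi> \<bullet> v = 0" if "T v \<phi>" for v \<phi>
    using that by (simp add: T_def)
  show "R (v - (\<phi> \<bullet> v / d) \<cdot>\<^sub>v u) (\<psi> + (\<psi> \<bullet> u) \<cdot>\<^sub>v \<phi>)" if "R u \<phi>" "R v \<psi>" for u \<phi> v \<psi>
    using conj_by_homology[OF that(1), of v \<psi>] that
      coset_conj_coset[of "rank_one n u \<phi>" "rank_one n v \<psi>"] by (simp add: R_def)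
  show "T (v - (\<phi> \<bullet> v / d) \<cdot>\<^sub>v u) (\<psi> + (\<psi> \<bullet> u) \<cdot>\<^sub>v \<phi>)" if "R u \<phi>" "T v \<psi>" for u \<phi> v \<psi>
    using conj_by_homology[OF that(1), of v \<psi>] that
      coset_conj_H[of "rank_one n u \<phi>" "rank_one n v \<psi>"] by (simp add: R_def T_def)
  show "\<exists>\<phi>. R u \<phi>" if u: "u \<in> carrier_vec n" "u \<noteq> 0\<^sub>v n" for u
  proof -
    obtain i where "C ^\<^sub>m i *\<^sub>v w = u" using transitive_vec[OF w(1) w_nonzero(1) u] by blast
    then show ?thesis using R_conj_H[OF C_pow_H[of i] base] by auto
  qed
  show "\<exists>u. R u \<phi>" if \<phi>: "\<phi> \<in> carrier_vec n" "\<phi> \<noteq> 0\<^sub>v n" for \<phi>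
  proof -
    obtain i where i: "(C ^\<^sub>m i)\<^sup>T *\<^sub>v \<eta> = \<phi>" using transitive_covec[OF w(2) w_nonzero(2) \<phi>] by blast
    let ?g = "inv\<^bsub>GLn\<^esub> (C ^\<^sub>m i)"
    have g: "?g \<in> H" by (rule subgroup.m_inv_closed[OF H C_pow_H])
    have "inv\<^bsub>GLn\<^esub> ?g = C ^\<^sub>m i" by (rule inv_inv[OF H_carrier[OF C_pow_H]])
    then show ?thesis using R_conj_H[OF g base] unfolding i[symmetric] by metis
  qed
  show "T v \<phi>" if u: "u \<in> carrier_vec n" "u \<noteq> 0\<^sub>v n" and v: "v \<in> carrier_vec n" "v \<noteq> 0\<^sub>v n"
    and sub: "\<And>\<psi>. T v \<psi> \<Longrightarrow> T u \<psi>" and "T u \<phi>" for u v \<phi>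
  proof -
    have fin: "finite {\<phi>. T u \<phi>}"
      by (rule finite_subset[OF _ card_carrier_vec(2)]) (auto simp: T_def)
    have "{\<phi>. T v \<phi>} = {\<phi>. T u \<phi>}"
      using card_seteq[OF fin _ card_T_le[OF u v]] sub by blast
    then show ?thesis using \<open>T u \<phi>\<close> by blast
  qed
qed

lemma rank_one_in_H:
  assumes "v \<in> carrier_vec n" "\<phi> \<in> carrier_vec n" "\<phi> \<bullet> v = 0"
  shows "rank_one n v \<phi> \<in> H"
proof (cases "\<phi> = 0\<^sub>v n")
  case True
  then show ?thesis using T_zero[OF assms(1)] by (simp add: T_def)
next
  case False
  then show ?thesis using all_transvections[of v \<phi>] assms by (simp add: T_def)
qed

text \<open>
  Dividing by a power of \<open>C\<close> of the same determinant reduces to determinant 1.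
\<close>
theorem H_eq_GL: "H = carrier GLn"
proof
  show "H \<subseteq> carrier GLn" using H_carrier by blast
  show "carrier GLn \<subseteq> H"
  proof
    fix A assume A: "A \<in> carrier GLn"
    then have "det A \<noteq> 0" by (simp add: GL_simps)
    then obtain i where i: "det C ^ i = det A" using det_generates by blast
    define g where "g = C ^\<^sub>m i"
    have g: "g \<in> H" "g \<in> carrier GLn" using C_pow_H H_carrier by (auto simp: g_def)
    have dg: "det g = det A" using i by (simp add: g_def det_pow)
    define B where "B = A \<otimes>\<^bsub>GLn\<^esub> inv\<^bsub>GLn\<^esub> g"
    have B: "B \<in> carrier GLn" using A g by (simp add: B_def)
    have Bg: "B \<otimes>\<^bsub>GLn\<^esub> g = A" using A g by (simp add: B_def m_assoc)
    have "det A = det B * det g"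
      using B g unfolding Bg[symmetric] GL_simps by (intro det_mult[of _ n]) auto
    then have "det B * det A = 1 * det A" unfolding dg by simp
    then have "det B = 1" by (simp only: mult_right_cancel[OF \<open>det A \<noteq> 0\<close>])
    moreover have "B \<in> carrier_mat n n" using B by (simp add: GL_simps)
    ultimately have "B \<in> H" by (intro SL_generated_by_transvections[OF H n rank_one_in_H])
    then show "A \<in> H" using subgroup.m_closed[OF H _ g(1)] Bg by metis
  qed
qed

end

section \<open>The cyclic permutation matrix\<close>

lemma degree_X_pow_minus_1:
  assumes "n > 0"
  shows "Polynomial.degree (Polynomial.monom 1 n - 1 :: 'a::comm_ring_1 poly) = n"
    "Polynomial.coeff (Polynomial.monom 1 n - 1 :: 'a poly) i = (if i = n then 1 else if i = 0 then - 1 else 0)"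
proof -
  show c: "Polynomial.coeff (Polynomial.monom 1 n - 1 :: 'a poly) i = (if i = n then 1 else if i = 0 then - 1 else 0)" for i
    using assms by (simp add: coeff_1)
  have "Polynomial.degree (Polynomial.monom 1 n - 1 :: 'a poly) \<le> n"
    by (intro degree_diff_le) (simp_all add: degree_monom_le)
  moreover have "n \<le> Polynomial.degree (Polynomial.monom 1 n - 1 :: 'a poly)"
    by (rule le_degree) (simp only: c, simp)
  ultimately show "Polynomial.degree (Polynomial.monom 1 n - 1 :: 'a poly) = n" by simp
qed

context
  fixes n :: nat and P :: "'a::field mat"
  assumes n: "n > 0"
  defines "P \<equiv> companion_mat (Polynomial.monom 1 n - 1)"
begin

lemma P_carrier: "P \<in> carrier_mat n n"
  unfolding P_def using companion_mat_carrier[of "Polynomial.monom 1 n - 1 :: 'a poly"] degree_X_pow_minus_1(1)[OF n, where 'a = 'a]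
  by simp

lemma P_entry:
  assumes "i < n" "j < n"
  shows "P $$ (i, j) = (if j = n - 1 then (if i = 0 then 1 else 0) else if i = j + 1 then 1 else 0)"
  unfolding P_def companion_mat_def Let_def degree_X_pow_minus_1(1)[OF n] degree_X_pow_minus_1(2)[OF n]
  using assms by simp

lemma det_P: "det P \<noteq> 0"
  unfolding P_def using det_companion_mat[OF degree_X_pow_minus_1(1)[OF n] n, where 'a = 'a]
  by (simp add: degree_X_pow_minus_1(2)[OF n] n)

lemma P_unit_vec:
  assumes "i < n"
  shows "P *\<^sub>v unit_vec n i = unit_vec n (Suc i mod n)"
proof (rule eq_vecI)
  fix k assume "k < dim_vec (unit_vec n (Suc i mod n) :: 'a vec)"
  then have k: "k < n" by simp
  have "(P *\<^sub>v unit_vec n i) $ k = P $$ (k, i)" using P_carrier k assms by simp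
  also have "\<dots> = unit_vec n (Suc i mod n) $ k"
  proof (cases "i = n - 1")
    case True
    then have "Suc i mod n = 0" using n by simp
    then show ?thesis using P_entry[OF k assms] True k by simp
  next
    case False
    then have "Suc i mod n = Suc i" using assms by simp
    then show ?thesis using P_entry[OF k assms] False k assms by simp
  qed
  finally show "(P *\<^sub>v unit_vec n i) $ k = unit_vec n (Suc i mod n) $ k" .
qed (use P_carrier in simp)

lemma P_pow_unit_vec:
  assumes "i < n"
  shows "P ^\<^sub>m k *\<^sub>v unit_vec n i = unit_vec n ((i + k) mod n)"
  using assms
proof (induction k arbitrary: i)
  case 0
  have "P ^\<^sub>m 0 = 1\<^sub>m n" using carrier_matD(1)[OF P_carrier] by simp
  then show ?case using 0 by simp
next
  case (Suc k)
  have "P ^\<^sub>m Suc k *\<^sub>v unit_vec n i = P ^\<^sub>m k *\<^sub>v (P *\<^sub>v unit_vec n i)"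
    using P_carrier pow_carrier_mat[OF P_carrier, of k] by (simp add: assoc_mult_mat_vec[of _ n n _ n])
  also have "\<dots> = unit_vec n ((Suc i mod n + k) mod n)"
    unfolding P_unit_vec[OF Suc.prems] using n by (intro Suc.IH) simp
  finally show ?case by (simp add: mod_add_left_eq)
qed

lemma P_pow_n: "P ^\<^sub>m n = 1\<^sub>m n"
proof -
  define Q where "Q = P ^\<^sub>m n"
  have Q: "Q \<in> carrier_mat n n" unfolding Q_def by (rule pow_carrier_mat[OF P_carrier])
  have "Q = 1\<^sub>m n"
  proof (rule eq_matI)
    fix i j assume "i < dim_row (1\<^sub>m n :: 'a mat)" "j < dim_col (1\<^sub>m n :: 'a mat)"
    then have ij: "i < n" "j < n" by auto
    have "Q $$ (i, j) = (Q *\<^sub>v unit_vec n j) $ i" using ij Q by simp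
    also have "\<dots> = unit_vec n j $ i" unfolding Q_def using P_pow_unit_vec[OF ij(2), of n] ij by simp
    finally show "Q $$ (i, j) = 1\<^sub>m n $$ (i, j)" using ij by simp
  qed (use Q in auto)
  then show ?thesis by (simp add: Q_def)
qed

text \<open>
  \<open>C\<close> and \<open>G\<close> differ only in the last column, and the first row of \<open>G\<close> is the last unit row, so a rank one
  change along the first coordinate turns one into the other.
\<close>
lemma companion_mat_factorization:
  assumes deg: "Polynomial.degree f = n"
  defines "w \<equiv> vec n (\<lambda>i. - Polynomial.coeff f i - (if i = 0 then 1 else 0))"
  shows "companion_mat f = rank_one n w (unit_vec n 0) * P"
proof (rule eq_matI)
  fix i j assume "i < dim_row (rank_one n w (unit_vec n 0) * P)" "j < dim_col (rank_one n w (unit_vec n 0) * P)"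
  then have ij: "i < n" "j < n" using P_carrier by (auto simp: rank_one_def)
  have w: "w \<in> carrier_vec n" by (simp add: w_def)
  have "(rank_one n w (unit_vec n 0) * P) $$ (i, j) = (rank_one n w (unit_vec n 0) *\<^sub>v col P j) $ i"
    using ij P_carrier by (simp add: rank_one_def)
  also have "\<dots> = P $$ (i, j) + P $$ (0, j) * w $ i"
    using ij P_carrier w n by (simp add: rank_one_mult_vec)
  also have "\<dots> = companion_mat f $$ (i, j)"
    using ij n deg by (simp add: P_entry companion_mat_def w_def)
  finally show "companion_mat f $$ (i, j) = (rank_one n w (unit_vec n 0) * P) $$ (i, j)" by simp
qed (use deg P_carrier in \<open>auto simp: companion_mat_def rank_one_def Let_def\<close>)

end

section \<open>The generated subgroup\<close>

text \<open>
  It remains to recognise the Singer cycle \<open>C\<close> and the homology \<open>D = C * inv G\<close>, whose ratio is \<open>d = -a_0\<close>.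
\<close>
theorem mainTheorem1:
  fixes p n :: nat
    and f :: "'p::prime_card mod_ring poly"
    and G :: "'p mod_ring mat"
    and Gs :: "nat \<Rightarrow> 'p mod_ring mat"
  defines "G \<equiv> companion_mat (monom 1 n - 1)"
  assumes "p = CARD('p)" and "n \<ge> 3"
    and "primitive_poly f" and "Polynomial.degree f = n"
    and "Gs 1 = companion_mat f"
    and "\<And>k. 1 \<le> k \<Longrightarrow> k \<le> n - 1 \<Longrightarrow>
           Gs (k + 1) = G * Gs k * inv\<^bsub>GL TYPE('p mod_ring) n\<^esub> G"
    and "p \<ge> 5" and "\<not> (p - 1) dvd n"
  shows "generate (GL TYPE('p mod_ring) n) (Gs ` {1..n}) = carrier (GL TYPE('p mod_ring) n)"
proof -
  note n3 = assms(3) and prim = assms(4) and deg = assms(5) and Gs1 = assms(6) and step = assms(7)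
  have p5: "CARD('p) \<ge> 5" using assms(2,8) by simp
  have n: "n > 0" using n3 by simp
  let ?GL = "GL TYPE('p mod_ring) n"
  let ?H = "generate ?GL (Gs ` {1..n})"
  let ?C = "companion_mat f"
  interpret GL: group ?GL by (rule group_GL)
  obtain x where "x \<noteq> 0" "is_minimal_poly f x"
    "\<And>m. m > 0 \<Longrightarrow> x ^ m = 1 \<Longrightarrow> CARD('p) ^ n - 1 \<le> m"
    using primitive_poly_root[OF prim] unfolding deg by blast
  then interpret singer_cycle f n x using deg n by unfold_locales
  define w where "w = vec n (\<lambda>i. - Polynomial.coeff f i - (if i = 0 then 1 else 0))"
  define \<eta> where "\<eta> = (unit_vec n 0 :: 'p mod_ring vec)"
  define d where "d = - Polynomial.coeff f 0"
  define D where "D = rank_one n w \<eta>"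
  have w: "w \<in> carrier_vec n" "\<eta> \<in> carrier_vec n" "\<eta> \<bullet> w = d - 1"
    using n by (auto simp: w_def \<eta>_def d_def)
  have G: "G \<in> carrier ?GL"
    using P_carrier[OF n, where 'a = "'p mod_ring"] det_P[OF n, where 'a = "'p mod_ring"]
    by (simp add: GL_simps G_def)
  have CGL: "?C \<in> carrier ?GL" using det_nonzero by (simp add: GL_simps)
  have DG: "?C = D * G"
    unfolding D_def \<eta>_def w_def G_def by (rule companion_mat_factorization[OF n deg])
  have "det ?C = det D * det G"
    unfolding DG using G by (intro det_mult[of _ n]) (auto simp: D_def GL_simps)
  then have D: "D \<in> carrier ?GL" using det_nonzero by (auto simp: D_def GL_simps)
  have Gk: "Gs k \<in> carrier ?GL \<and> Gs k = G [^]\<^bsub>?GL\<^esub> (k - 1) \<otimes>\<^bsub>?GL\<^esub> ?C \<otimes>\<^bsub>?GL\<^esub> inv\<^bsub>?GL\<^esub> (G [^]\<^bsub>?GL\<^esub> (k - 1))"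
    if "1 \<le> k" "k \<le> n" for k
    using that
  proof (induction k rule: dec_induct)
    case base
    then show ?case using Gs1 CGL by simp
  next
    case (step k)
    have IH: "Gs k = G [^]\<^bsub>?GL\<^esub> (k - 1) \<otimes>\<^bsub>?GL\<^esub> ?C \<otimes>\<^bsub>?GL\<^esub> inv\<^bsub>?GL\<^esub> (G [^]\<^bsub>?GL\<^esub> (k - 1))"
      "Gs k \<in> carrier ?GL" using step by auto
    have S: "Gs (Suc k) = G \<otimes>\<^bsub>?GL\<^esub> Gs k \<otimes>\<^bsub>?GL\<^esub> inv\<^bsub>?GL\<^esub> G"
      using assms(7)[of k] step by (simp add: GL_simps)
    have pow: "G [^]\<^bsub>?GL\<^esub> (Suc k - 1) = G \<otimes>\<^bsub>?GL\<^esub> G [^]\<^bsub>?GL\<^esub> (k - 1)"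
      using GL.nat_pow_Suc2[OF G, of "k - 1"] step by simp
    have "Gs (Suc k) \<in> carrier ?GL" unfolding S using G IH(2) by simp
    moreover have "Gs (Suc k) = G [^]\<^bsub>?GL\<^esub> (Suc k - 1) \<otimes>\<^bsub>?GL\<^esub> ?C \<otimes>\<^bsub>?GL\<^esub> inv\<^bsub>?GL\<^esub> (G [^]\<^bsub>?GL\<^esub> (Suc k - 1))"
      unfolding S pow IH(1) using G CGL by (simp add: GL.m_assoc GL.inv_mult_group)
    ultimately show ?case by blast
  qed
  have gens: "Gs ` {1..n} \<subseteq> carrier ?GL" using Gk by (intro image_subsetI) (metis atLeastAtMost_iff)
  have H: "subgroup ?H ?GL" by (rule GL.generate_is_subgroup[OF gens])
  have C_in: "?C \<in> ?H" using generate.incl[of "Gs 1" "Gs ` {1..n}" ?GL] n Gs1 by simp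
  have Gn: "G [^]\<^bsub>?GL\<^esub> n = \<one>\<^bsub>?GL\<^esub>"
  proof -
    have "G [^]\<^bsub>?GL\<^esub> k = G ^\<^sub>m k" for k
    proof (induction k)
      case 0
      have "G ^\<^sub>m 0 = 1\<^sub>m n" using G by (auto simp: GL_simps)
      then show ?case by (simp add: GL_simps)
    next
      case (Suc k)
      then show ?case by (simp add: GL_simps)
    qed
    then show ?thesis using P_pow_n[OF n, where 'a = "'p mod_ring"] by (simp add: GL_simps G_def)
  qed
  \<comment> \<open>Conjugation by \<open>G\<close> sends \<open>G_k\<close> to \<open>G_{k+1}\<close>, and \<open>G_n\<close> back to \<open>G_1\<close> because \<open>G ^ n = 1\<close>.\<close>
  have conj_gen: "G \<otimes>\<^bsub>?GL\<^esub> s \<otimes>\<^bsub>?GL\<^esub> inv\<^bsub>?GL\<^esub> G \<in> ?H" if s: "s \<in> Gs ` {1..n}" for s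
  proof -
    obtain k where k: "1 \<le> k" "k \<le> n" "s = Gs k" using s by auto
    show ?thesis
    proof (cases "k = n")
      case False
      then have "G \<otimes>\<^bsub>?GL\<^esub> s \<otimes>\<^bsub>?GL\<^esub> inv\<^bsub>?GL\<^esub> G = Gs (k + 1)"
        using step[of k] k by (simp add: GL_simps)
      moreover have "k + 1 \<in> {1..n}" using k False by simp
      ultimately show ?thesis by (metis generate.incl imageI)
    next
      case True
      have pow: "G \<otimes>\<^bsub>?GL\<^esub> G [^]\<^bsub>?GL\<^esub> (n - 1) = \<one>\<^bsub>?GL\<^esub>"
        using GL.nat_pow_Suc2[OF G, of "n - 1"] n Gn by simp
      let ?A = "G [^]\<^bsub>?GL\<^esub> (n - 1)"
      have A: "?A \<in> carrier ?GL" using G by simp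
      have s: "s = ?A \<otimes>\<^bsub>?GL\<^esub> ?C \<otimes>\<^bsub>?GL\<^esub> inv\<^bsub>?GL\<^esub> ?A" using Gk[OF k(1,2)] k(3) True by simp
      have "G \<otimes>\<^bsub>?GL\<^esub> s \<otimes>\<^bsub>?GL\<^esub> inv\<^bsub>?GL\<^esub> G
          = (G \<otimes>\<^bsub>?GL\<^esub> ?A) \<otimes>\<^bsub>?GL\<^esub> ?C \<otimes>\<^bsub>?GL\<^esub> inv\<^bsub>?GL\<^esub> (G \<otimes>\<^bsub>?GL\<^esub> ?A)"
        unfolding s GL.inv_mult_group[OF G A] using G A CGL by (simp add: GL.m_assoc)
      also have "\<dots> = ?C" unfolding pow using CGL by simp
      finally show ?thesis using C_in by simp
    qed
  qed
  have normal: "inv\<^bsub>?GL\<^esub> D \<otimes>\<^bsub>?GL\<^esub> h \<otimes>\<^bsub>?GL\<^esub> D \<in> ?H" if h: "h \<in> ?H" for h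
  proof -
    have hc: "h \<in> carrier ?GL" using GL.generate_in_carrier[OF gens h] .
    have C_eq: "?C = D \<otimes>\<^bsub>?GL\<^esub> G" unfolding DG by (simp add: GL_simps)
    have "D = ?C \<otimes>\<^bsub>?GL\<^esub> inv\<^bsub>?GL\<^esub> G"
      unfolding C_eq using D G by (simp add: GL.m_assoc)
    then have "inv\<^bsub>?GL\<^esub> D \<otimes>\<^bsub>?GL\<^esub> h \<otimes>\<^bsub>?GL\<^esub> D =
        inv\<^bsub>?GL\<^esub> (?C \<otimes>\<^bsub>?GL\<^esub> inv\<^bsub>?GL\<^esub> G) \<otimes>\<^bsub>?GL\<^esub> h \<otimes>\<^bsub>?GL\<^esub> (?C \<otimes>\<^bsub>?GL\<^esub> inv\<^bsub>?GL\<^esub> G)" by metis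
    also have "\<dots> = G \<otimes>\<^bsub>?GL\<^esub> (inv\<^bsub>?GL\<^esub> ?C \<otimes>\<^bsub>?GL\<^esub> h \<otimes>\<^bsub>?GL\<^esub> ?C) \<otimes>\<^bsub>?GL\<^esub> inv\<^bsub>?GL\<^esub> G"
      using G CGL hc by (simp add: GL.inv_mult_group GL.m_assoc)
    also have "\<dots> \<in> ?H"
      by (intro GL.conj_generate[OF gens G conj_gen] subgroup.m_closed[OF H] subgroup.m_inv_closed[OF H] C_in h)
    finally show ?thesis .
  qed
  have d0: "d \<noteq> 0" using det_nonzero unfolding det_companion_mat[OF deg n] by (auto simp: d_def)
  \<comment> \<open>The sign \<open>(-1) ^ n\<close> in \<open>det C\<close> disappears in the square, and \<open>det C\<close> has order at least \<open>p - 1 > 2\<close>.\<close>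
  have "d * d = det ?C ^ 2"
    unfolding det_companion_mat[OF deg n] d_def by (simp add: power2_eq_square power_mult_distrib flip: power_mult)
  then have dd: "d * d \<noteq> 1" using det_order[of 2] p5 by auto
  have two: "(2 :: 'p mod_ring) \<noteq> 0"
    using of_nat_0_mod_ring_dvd[where 'a = 'p, of 2] dvd_imp_le[of "CARD('p)" 2] p5 by auto
  interpret singer_homology f n x ?H w \<eta> d
    by (unfold_locales; (fact subgroup.subset[OF H] subgroup.m_closed[OF H] subgroup.one_closed[OF H]
      subgroup.m_inv_closed[OF H] H D[unfolded D_def] normal[unfolded D_def] n3 two d0 dd w C_in)?)
  show ?thesis by (rule H_eq_GL)
qed

end
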